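(* Let $(A,d_A)$ be a differential algebra of weight $\lambda$ and let $V$ be a vector space with $d_V\in\mathrm{End}_{\mathbf{k}}(V)$. For a given bimodule structure on $(V,d_V)$ over $(A,d_A)$, abelian extensions of $(A,d_A)$ by $(V,d_V)$ inducing this bimodule structure are classified, up to isomorphism, by the second cohomology group $\tilde H^2_{\mathsf{DA}_\lambda}(A,V)$ of $(A,d_A)$ with coefficients in the bimodule $(V,d_V)$: sending an abelian extension $(\hat A,d_{\hat A})$ with a section $s$ to the class of $(\psi,\chi)$, where $\psi(x,y)=s(x)s(y)-s(xy)$ and $\chi(x)=d_{\hat A}(s(x))-s(d_A(x))$ for $x,y\in A$, gives a well-defined bijection from the set of isomorphism classes of such abelian extensions to $\tilde H^2_{\mathsf{DA}_\lambda}(A,V)$.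
   Context: Throughout, $\mathbf{k}$ is a field of characteristic zero; all vector spaces, algebras, linear maps and tensor products are over $\mathbf{k}$. Fix $\lambda\in\mathbf{k}$. A differential algebra of weight $\lambda$ is an associative algebra $A$ with a linear operator $d_A:A\to A$ such that $d_A(xy)=d_A(x)y+xd_A(y)+\lambda d_A(x)d_A(y)$ for all $x,y\in A$; if $A$ is unital one further requires $d_A(1_A)=0$. Homomorphisms are algebra homomorphisms commuting with the operators. A bimodule over $(A,d_A)$ is a bimodule $V$ over the associative algebra $A$ (left action $xv$, right action $vx$) with $d_V\in\mathrm{End}_{\mathbf{k}}(V)$ such that $d_V(xv)=d_A(x)v+xd_V(v)+\lambda d_A(x)d_V(v)$ and $d_V(vx)=vd_A(x)+d_V(v)x+\lambda d_V(v)d_A(x)$ for all $x\in A,v\in V$. Write $x\vdash_\lambda v=(x+\lambda d_A(x))v$ and $v\dashv_\lambda x=v(x+\lambda d_A(x))$. An abelian extension of $(A,d_A)$ by $(V,d_V)$ is a short exact sequence of homomorphisms of differential algebras of weight $\lambda$, $0\to(V,d_V)\xrightarrow{i}(\hat A,d_{\hat A})\xrightarrow{p}(A,d_A)\to0$, such that $uv=0$ for all $u,v\in V$ ($V$ is identified with $i(V)$). Two abelian extensions $(\hat A_1,d_{\hat A_1})$ and $(\hat A_2,d_{\hat A_2})$ are isomorphic if there is an isomorphism of differential algebras $\zeta:(\hat A_1,d_{\hat A_1})\to(\hat A_2,d_{\hat A_2})$ compatible with the identity maps of $V$ and $A$ (i.e. $\zeta\circ i_1=i_2$, $p_2\circ\zeta=p_1$).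 A section is a linear map $s:A\to\hat A$ with $p\circ s=\mathrm{Id}_A$. An abelian extension induces on $(V,d_V)$ the bimodule structure over $(A,d_A)$ given by $xv:=s(x)v$, $vx:=vs(x)$ (independent of the section $s$). $\tilde H^2_{\mathsf{DA}_\lambda}(A,V)$ is the second cohomology of the complex with $\tilde C^0=0$, $\tilde C^1=\mathrm{Hom}(A,V)$, $\tilde C^n=\mathrm{Hom}(A^{\otimes n},V)\oplus\mathrm{Hom}(A^{\otimes(n-1)},V)$ for $n\ge2$, a subcomplex of the complex with differential $\partial_{\mathsf{DA}_\lambda}(f,g)=(\partial f,\partial_\lambda g+(-1)^n\delta f)$. Explicitly: the 2-cocycles are the pairs $(f,g)\in\mathrm{Hom}(A^{\otimes2},V)\oplus\mathrm{Hom}(A,V)$ with $\partial f=0$ and $\partial_\lambda g+\delta f=0$, where $\partial f(x,y,z)=xf(y,z)-f(xy,z)+f(x,yz)-f(x,y)z$, $\ \partial_\lambda g(x,y)=x\vdash_\lambda g(y)-g(xy)+g(x)\dashv_\lambda y$, $\ \delta f(x,y)=f(d_A(x),y)+f(x,d_A(y))+\lambda f(d_A(x),d_A(y))-d_V(f(x,y))$; the 2-coboundaries are the pairs $\partial_{\mathsf{DA}_\lambda}(\phi)=(\partial\phi,-\delta\phi)$ for $\phi\in\mathrm{Hom}(A,V)$, where $\partial\phi(x,y)=x\phi(y)-\phi(xy)+\phi(x)y$ and $\delta\phi(x)=\phi(d_A(x))-d_V(\phi(x))$. *)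

theory Defs
  imports "HOL-Algebra.Module" "HOL-Algebra.Coset"
begin

section \<open>Linear and bilinear maps\<close>

text \<open>
  Algebras and vector spaces over a field \<open>K\<close> are structures based on the record of
  \<^locale>\<open>module\<close>; the field \<open>one\<close> of that record is never used for them, since algebras
  need not be unital, and the field \<open>mult\<close> is not used for a bare vector space.
\<close>

record ('k, 'a) diff_module = "('k, 'a) module" +
  dop :: "'a \<Rightarrow> 'a"

definition linear_maps ::
  "('k, 'm) ring_scheme \<Rightarrow> ('k, 'a, 'r) module_scheme \<Rightarrow> ('k, 'b, 's) module_scheme \<Rightarrow> ('a \<Rightarrow> 'b) set"
  where "linear_maps K M N = {f \<in> carrier M \<rightarrow> carrier N.
     (\<forall>x\<in>carrier M. \<forall>y\<in>carrier M. f (x \<oplus>\<^bsub>M\<^esub> y) = f x \<oplus>\<^bsub>N\<^esub> f y) \<and>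
     (\<forall>c\<in>carrier K. \<forall>x\<in>carrier M. f (c \<odot>\<^bsub>M\<^esub> x) = c \<odot>\<^bsub>N\<^esub> f x)}"

definition bilinear_map ::
  "('k, 'm) ring_scheme \<Rightarrow> ('k, 'a, 'r) module_scheme \<Rightarrow> ('k, 'b, 's) module_scheme \<Rightarrow>
   ('k, 'c, 't) module_scheme \<Rightarrow> ('a \<Rightarrow> 'b \<Rightarrow> 'c) \<Rightarrow> bool"
  where "bilinear_map K M N P f \<longleftrightarrow>
     (\<forall>x\<in>carrier M. (\<lambda>y. f x y) \<in> linear_maps K N P) \<and>
     (\<forall>y\<in>carrier N. (\<lambda>x. f x y) \<in> linear_maps K M P)"

text \<open>
  \<open>Hom1 K M N\<close> is \<open>Hom(M, N)\<close> and \<open>Hom2 K M N\<close> is \<open>Hom(M \<otimes> M, N)\<close>, the latter as bilinear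
  maps on pairs. Maps are \<^const>\<open>undefined\<close> outside the carriers, so that equality
  of functions is equality of maps.
\<close>

definition Hom1 ::
  "('k, 'm) ring_scheme \<Rightarrow> ('k, 'a, 'r) module_scheme \<Rightarrow> ('k, 'b, 's) module_scheme \<Rightarrow> ('a \<Rightarrow> 'b) set"
  where "Hom1 K M N = linear_maps K M N \<inter> extensional (carrier M)"

definition Hom2 ::
  "('k, 'm) ring_scheme \<Rightarrow> ('k, 'a, 'r) module_scheme \<Rightarrow> ('k, 'b, 's) module_scheme \<Rightarrow>
   ('a \<times> 'a \<Rightarrow> 'b) set"
  where "Hom2 K M N =
    {f \<in> extensional (carrier M \<times> carrier M). bilinear_map K M M N (\<lambda>x y. f (x, y))}"

section \<open>Differential algebras of weight \<open>lam\<close> and their bimodules\<close>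

locale diff_algebra = field K + module K A
  for K :: "('k, 'm) ring_scheme" (structure) and lam :: 'k
    and A :: "('k, 'a, 'r) diff_module_scheme" +
  assumes mult_bilinear: "bilinear_map K A A A (\<lambda>x y. x \<otimes>\<^bsub>A\<^esub> y)"
    and mult_assoc: "\<lbrakk>x \<in> carrier A; y \<in> carrier A; z \<in> carrier A\<rbrakk> \<Longrightarrow>
      (x \<otimes>\<^bsub>A\<^esub> y) \<otimes>\<^bsub>A\<^esub> z = x \<otimes>\<^bsub>A\<^esub> (y \<otimes>\<^bsub>A\<^esub> z)"
    and dop_linear: "dop A \<in> linear_maps K A A"
    and dop_mult: "\<lbrakk>x \<in> carrier A; y \<in> carrier A\<rbrakk> \<Longrightarrow>
      dop A (x \<otimes>\<^bsub>A\<^esub> y) =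
        dop A x \<otimes>\<^bsub>A\<^esub> y \<oplus>\<^bsub>A\<^esub> x \<otimes>\<^bsub>A\<^esub> dop A y \<oplus>\<^bsub>A\<^esub> lam \<odot>\<^bsub>A\<^esub> (dop A x \<otimes>\<^bsub>A\<^esub> dop A y)"
    \<comment> \<open>if the algebra happens to have an identity element, the operator kills it\<close>
    and dop_unit: "\<lbrakk>e \<in> carrier A; \<forall>x\<in>carrier A. e \<otimes>\<^bsub>A\<^esub> x = x \<and> x \<otimes>\<^bsub>A\<^esub> e = x\<rbrakk> \<Longrightarrow>
      dop A e = \<zero>\<^bsub>A\<^esub>"

record ('k, 'v, 'a) diff_bimod = "('k, 'v) diff_module" +
  lact :: "'a \<Rightarrow> 'v \<Rightarrow> 'v"
  ract :: "'v \<Rightarrow> 'a \<Rightarrow> 'v"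

locale diff_bimodule = diff_algebra K lam A + V: module K V
  for K :: "('k, 'm) ring_scheme" (structure) and lam :: 'k
    and A :: "('k, 'a, 'r) diff_module_scheme"
    and V :: "('k, 'v, 'a, 's) diff_bimod_scheme" +
  assumes dopV_linear: "dop V \<in> linear_maps K V V"
    and lact_bilinear: "bilinear_map K A V V (lact V)"
    and ract_bilinear: "bilinear_map K V A V (ract V)"
    and lact_mult: "\<lbrakk>x \<in> carrier A; y \<in> carrier A; v \<in> carrier V\<rbrakk> \<Longrightarrow>
      lact V (x \<otimes>\<^bsub>A\<^esub> y) v = lact V x (lact V y v)"
    and ract_mult: "\<lbrakk>x \<in> carrier A; y \<in> carrier A; v \<in> carrier V\<rbrakk> \<Longrightarrow>
      ract V v (x \<otimes>\<^bsub>A\<^esub> y) = ract V (ract V v x) y"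
    and lact_ract: "\<lbrakk>x \<in> carrier A; y \<in> carrier A; v \<in> carrier V\<rbrakk> \<Longrightarrow>
      ract V (lact V x v) y = lact V x (ract V v y)"
    and dopV_lact: "\<lbrakk>x \<in> carrier A; v \<in> carrier V\<rbrakk> \<Longrightarrow>
      dop V (lact V x v) =
        lact V (dop A x) v \<oplus>\<^bsub>V\<^esub> lact V x (dop V v) \<oplus>\<^bsub>V\<^esub> lam \<odot>\<^bsub>V\<^esub> lact V (dop A x) (dop V v)"
    and dopV_ract: "\<lbrakk>x \<in> carrier A; v \<in> carrier V\<rbrakk> \<Longrightarrow>
      dop V (ract V v x) =
        ract V v (dop A x) \<oplus>\<^bsub>V\<^esub> ract V (dop V v) x \<oplus>\<^bsub>V\<^esub> lam \<odot>\<^bsub>V\<^esub> ract V (dop V v) (dop A x)"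

definition diff_hom ::
  "('k, 'm) ring_scheme \<Rightarrow> ('k, 'a, 'r) diff_module_scheme \<Rightarrow> ('k, 'b, 's) diff_module_scheme \<Rightarrow>
   ('a \<Rightarrow> 'b) set"
  where "diff_hom K A B = {f \<in> linear_maps K A B.
     (\<forall>x\<in>carrier A. \<forall>y\<in>carrier A. f (x \<otimes>\<^bsub>A\<^esub> y) = f x \<otimes>\<^bsub>B\<^esub> f y) \<and>
     (\<forall>x\<in>carrier A. f (dop A x) = dop B (f x))}"

section \<open>Abelian extensions\<close>

record ('k, 'a, 'v, 'e) extension =
  ext_alg :: "('k, 'e) diff_module"
  incl :: "'v \<Rightarrow> 'e"
  proj :: "'e \<Rightarrow> 'a"

text \<open>
  \<open>V\<close> as a differential algebra with \<open>u v = 0\<close>. The condition that products of elements of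
  \<open>V\<close> vanish in an abelian extension is thus part of the inclusion being a homomorphism.
\<close>

definition zero_product ::
  "('k, 'v, 's) diff_module_scheme \<Rightarrow> ('k, 'v, 's) diff_module_scheme"
  where "zero_product V = V\<lparr>mult := (\<lambda>u v. \<zero>\<^bsub>V\<^esub>)\<rparr>"

definition abelian_extension ::
  "('k, 'm) ring_scheme \<Rightarrow> 'k \<Rightarrow> ('k, 'a, 'r) diff_module_scheme \<Rightarrow>
   ('k, 'v, 's) diff_module_scheme \<Rightarrow> ('k, 'a, 'v, 'e) extension \<Rightarrow> bool"
  where "abelian_extension K lam A V E \<longleftrightarrow>
     diff_algebra K lam (ext_alg E) \<and>
     incl E \<in> diff_hom K (zero_product V) (ext_alg E) \<and>
     proj E \<in> diff_hom K (ext_alg E) A \<and>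
     inj_on (incl E) (carrier V) \<and>
     incl E ` carrier V = {e \<in> carrier (ext_alg E). proj E e = \<zero>\<^bsub>A\<^esub>} \<and>
     proj E ` carrier (ext_alg E) = carrier A"

definition sections ::
  "('k, 'm) ring_scheme \<Rightarrow> ('k, 'a, 'r) diff_module_scheme \<Rightarrow> ('k, 'a, 'v, 'e) extension \<Rightarrow>
   ('a \<Rightarrow> 'e) set"
  where "sections K A E =
    {s \<in> linear_maps K A (ext_alg E). \<forall>x\<in>carrier A. proj E (s x) = x}"

definition induces_bimodule ::
  "('k, 'm) ring_scheme \<Rightarrow> ('k, 'a, 'r) diff_module_scheme \<Rightarrow>
   ('k, 'v, 'a, 's) diff_bimod_scheme \<Rightarrow> ('k, 'a, 'v, 'e) extension \<Rightarrow> bool"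
  where "induces_bimodule K A V E \<longleftrightarrow>
    (\<forall>s\<in>sections K A E. \<forall>x\<in>carrier A. \<forall>v\<in>carrier V.
       incl E (lact V x v) = s x \<otimes>\<^bsub>ext_alg E\<^esub> incl E v \<and>
       incl E (ract V v x) = incl E v \<otimes>\<^bsub>ext_alg E\<^esub> s x)"

text \<open>
  The type \<open>'e\<close> is the universe from which the underlying sets of the extensions are taken.
\<close>

definition abelian_extensions ::
  "('k, 'm) ring_scheme \<Rightarrow> 'k \<Rightarrow> ('k, 'a, 'r) diff_module_scheme \<Rightarrow>
   ('k, 'v, 'a, 's) diff_bimod_scheme \<Rightarrow> ('k, 'a, 'v, 'e) extension set"
  where "abelian_extensions K lam A V =
    {E. abelian_extension K lam A V E \<and> induces_bimodule K A V E}"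

definition isomorphic_extensions ::
  "('k, 'm) ring_scheme \<Rightarrow> ('k, 'v, 's) diff_module_scheme \<Rightarrow>
   ('k, 'a, 'v, 'e) extension \<Rightarrow> ('k, 'a, 'v, 'f) extension \<Rightarrow> bool"
  where "isomorphic_extensions K V E1 E2 \<longleftrightarrow>
    (\<exists>\<zeta>\<in>diff_hom K (ext_alg E1) (ext_alg E2).
       bij_betw \<zeta> (carrier (ext_alg E1)) (carrier (ext_alg E2)) \<and>
       (\<forall>v\<in>carrier V. \<zeta> (incl E1 v) = incl E2 v) \<and>
       (\<forall>e\<in>carrier (ext_alg E1). proj E2 (\<zeta> e) = proj E1 e))"

definition extension_iso_rel ::
  "('k, 'm) ring_scheme \<Rightarrow> 'k \<Rightarrow> ('k, 'a, 'r) diff_module_scheme \<Rightarrow>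
   ('k, 'v, 'a, 's) diff_bimod_scheme \<Rightarrow>
   (('k, 'a, 'v, 'e) extension \<times> ('k, 'a, 'v, 'e) extension) set"
  where "extension_iso_rel K lam A V =
    {(E1, E2). E1 \<in> abelian_extensions K lam A V \<and> E2 \<in> abelian_extensions K lam A V \<and>
       isomorphic_extensions K V E1 E2}"

section \<open>Second cohomology\<close>

context
  fixes K :: "('k, 'm) ring_scheme" and lam :: 'k
    and A :: "('k, 'a, 'r) diff_module_scheme"
    and V :: "('k, 'v, 'a, 's) diff_bimod_scheme"
begin

definition lam_lact :: "'a \<Rightarrow> 'v \<Rightarrow> 'v"
  where "lam_lact x v = lact V (x \<oplus>\<^bsub>A\<^esub> lam \<odot>\<^bsub>A\<^esub> dop A x) v"

definition lam_ract :: "'v \<Rightarrow> 'a \<Rightarrow> 'v"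
  where "lam_ract v x = ract V v (x \<oplus>\<^bsub>A\<^esub> lam \<odot>\<^bsub>A\<^esub> dop A x)"

definition hoch_d1 :: "('a \<Rightarrow> 'v) \<Rightarrow> 'a \<Rightarrow> 'a \<Rightarrow> 'v"
  where "hoch_d1 \<phi> x y = lact V x (\<phi> y) \<ominus>\<^bsub>V\<^esub> \<phi> (x \<otimes>\<^bsub>A\<^esub> y) \<oplus>\<^bsub>V\<^esub> ract V (\<phi> x) y"

definition hoch_d2 :: "('a \<times> 'a \<Rightarrow> 'v) \<Rightarrow> 'a \<Rightarrow> 'a \<Rightarrow> 'a \<Rightarrow> 'v"
  where "hoch_d2 f x y z =
    lact V x (f (y, z)) \<ominus>\<^bsub>V\<^esub> f (x \<otimes>\<^bsub>A\<^esub> y, z) \<oplus>\<^bsub>V\<^esub> f (x, y \<otimes>\<^bsub>A\<^esub> z) \<ominus>\<^bsub>V\<^esub> ract V (f (x, y)) z"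

definition hoch_d1_lam :: "('a \<Rightarrow> 'v) \<Rightarrow> 'a \<Rightarrow> 'a \<Rightarrow> 'v"
  where "hoch_d1_lam g x y = lam_lact x (g y) \<ominus>\<^bsub>V\<^esub> g (x \<otimes>\<^bsub>A\<^esub> y) \<oplus>\<^bsub>V\<^esub> lam_ract (g x) y"

definition delta1 :: "('a \<Rightarrow> 'v) \<Rightarrow> 'a \<Rightarrow> 'v"
  where "delta1 \<phi> x = \<phi> (dop A x) \<ominus>\<^bsub>V\<^esub> dop V (\<phi> x)"

definition delta2 :: "('a \<times> 'a \<Rightarrow> 'v) \<Rightarrow> 'a \<Rightarrow> 'a \<Rightarrow> 'v"
  where "delta2 f x y =
    f (dop A x, y) \<oplus>\<^bsub>V\<^esub> f (x, dop A y) \<oplus>\<^bsub>V\<^esub> lam \<odot>\<^bsub>V\<^esub> f (dop A x, dop A y) \<ominus>\<^bsub>V\<^esub> dop V (f (x, y))"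

definition cocycles2 :: "(('a \<times> 'a \<Rightarrow> 'v) \<times> ('a \<Rightarrow> 'v)) set"
  where "cocycles2 = {(f, g). f \<in> Hom2 K A V \<and> g \<in> Hom1 K A V \<and>
     (\<forall>x\<in>carrier A. \<forall>y\<in>carrier A. \<forall>z\<in>carrier A. hoch_d2 f x y z = \<zero>\<^bsub>V\<^esub>) \<and>
     (\<forall>x\<in>carrier A. \<forall>y\<in>carrier A. hoch_d1_lam g x y \<oplus>\<^bsub>V\<^esub> delta2 f x y = \<zero>\<^bsub>V\<^esub>)}"

definition cobdry :: "('a \<Rightarrow> 'v) \<Rightarrow> ('a \<times> 'a \<Rightarrow> 'v) \<times> ('a \<Rightarrow> 'v)"
  where "cobdry \<phi> =
    ((\<lambda>(x, y)\<in>carrier A \<times> carrier A. hoch_d1 \<phi> x y),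
     (\<lambda>x\<in>carrier A. \<ominus>\<^bsub>V\<^esub> delta1 \<phi> x))"

definition coboundaries2 :: "(('a \<times> 'a \<Rightarrow> 'v) \<times> ('a \<Rightarrow> 'v)) set"
  where "coboundaries2 = cobdry ` Hom1 K A V"

definition cocycle_group :: "(('a \<times> 'a \<Rightarrow> 'v) \<times> ('a \<Rightarrow> 'v)) monoid"
  where "cocycle_group = \<lparr>carrier = cocycles2,
     mult = (\<lambda>(f, g) (f', g').
       ((\<lambda>p\<in>carrier A \<times> carrier A. f p \<oplus>\<^bsub>V\<^esub> f' p), (\<lambda>x\<in>carrier A. g x \<oplus>\<^bsub>V\<^esub> g' x))),
     one = ((\<lambda>p\<in>carrier A \<times> carrier A. \<zero>\<^bsub>V\<^esub>), (\<lambda>x\<in>carrier A. \<zero>\<^bsub>V\<^esub>))\<rparr>"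

definition cohomology2 :: "(('a \<times> 'a \<Rightarrow> 'v) \<times> ('a \<Rightarrow> 'v)) set monoid"
  where "cohomology2 = cocycle_group Mod coboundaries2"

definition cohomology_class ::
  "('a \<times> 'a \<Rightarrow> 'v) \<times> ('a \<Rightarrow> 'v) \<Rightarrow> (('a \<times> 'a \<Rightarrow> 'v) \<times> ('a \<Rightarrow> 'v)) set"
  where "cohomology_class c = coboundaries2 #>\<^bsub>cocycle_group\<^esub> c"

end

text \<open>
  The pair \<open>(\<psi>, \<chi>)\<close> of an extension with a section; \<open>V\<close> is identified with its image, so the
  values are pulled back along the inclusion.
\<close>

definition section_cocycle ::
  "('k, 'a, 'r) diff_module_scheme \<Rightarrow> ('k, 'v, 's) diff_module_scheme \<Rightarrow>
   ('k, 'a, 'v, 'e) extension \<Rightarrow> ('a \<Rightarrow> 'e) \<Rightarrow> ('a \<times> 'a \<Rightarrow> 'v) \<times> ('a \<Rightarrow> 'v)"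
  where "section_cocycle A V E s =
    ((\<lambda>(x, y)\<in>carrier A \<times> carrier A. inv_into (carrier V) (incl E)
        (s x \<otimes>\<^bsub>ext_alg E\<^esub> s y \<ominus>\<^bsub>ext_alg E\<^esub> s (x \<otimes>\<^bsub>A\<^esub> y))),
     (\<lambda>x\<in>carrier A. inv_into (carrier V) (incl E)
        (dop (ext_alg E) (s x) \<ominus>\<^bsub>ext_alg E\<^esub> s (dop A x))))"

end

theory Submission
  imports Defs
begin

text \<open>
  A pair \<open>c = (f, g)\<close> of maps into \<open>V\<close> twists the multiplication and the operator of the direct
  sum of \<open>A\<close> and \<open>V\<close>, and the result is a differential algebra if and only if \<open>c\<close> is a
  2-cocycle. A section \<open>s\<close> of an extension \<open>E\<close> identifies \<open>E\<close>, via \<open>(x, v) \<mapsto> s x + v\<close>, with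
  the sum twisted by its pair \<open>(\<psi>, \<chi>)\<close>; in particular this pair is a cocycle. An isomorphism of two
  twisted sums has the form \<open>(x, v) \<mapsto> (x, v + \<phi> x)\<close>, and such a map is an isomorphism
  exactly when the two cocycles differ by the coboundary of \<open>\<phi>\<close>. So the cohomology class of
  \<open>c\<close> is the set of all cocycles whose twisted sum is isomorphic to that of \<open>c\<close>, and the bijection
  sends the class of \<open>E\<close> to the set of all cocycles whose twisted sum is isomorphic to \<open>E\<close>.
\<close>

section \<open>Linear maps\<close>

text \<open>Registers the additive group laws with the method \<open>algebra\<close>, so that it
  normalises sums and differences in the underlying group of a vector space such as
  \<open>V\<close>.\<close>

lemmas (in abelian_group) abelian_group_simprules
  [algebra abelian_group "zero G" "add G" "a_inv G" "a_minus G"] =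
  a_closed zero_closed a_inv_closed minus_closed a_assoc l_zero l_neg a_comm minus_eq
  r_zero r_neg r_neg2 r_neg1 minus_add minus_minus minus_zero a_lcomm

lemma (in abelian_group) add_minus_cancel:
  "\<lbrakk>x \<in> carrier G; y \<in> carrier G\<rbrakk> \<Longrightarrow> x \<oplus> (y \<ominus> x) = y"
  by algebra

lemma linear_mapsD:
  assumes "f \<in> linear_maps K M N"
  shows linear_maps_closed: "\<And>x. x \<in> carrier M \<Longrightarrow> f x \<in> carrier N"
    and linear_maps_add: "\<And>x y. \<lbrakk>x \<in> carrier M; y \<in> carrier M\<rbrakk> \<Longrightarrow> f (x \<oplus>\<^bsub>M\<^esub> y) = f x \<oplus>\<^bsub>N\<^esub> f y"
    and linear_maps_smult:
      "\<And>c x. \<lbrakk>c \<in> carrier K; x \<in> carrier M\<rbrakk> \<Longrightarrow> f (c \<odot>\<^bsub>M\<^esub> x) = c \<odot>\<^bsub>N\<^esub> f x"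
  using assms by (auto simp: linear_maps_def)

lemma linear_maps_zero:
  assumes "module K M" "module K N" "f \<in> linear_maps K M N"
  shows "f \<zero>\<^bsub>M\<^esub> = \<zero>\<^bsub>N\<^esub>"
proof -
  interpret M: module K M by fact
  interpret N: module K N by fact
  have "f (\<zero>\<^bsub>K\<^esub> \<odot>\<^bsub>M\<^esub> \<zero>\<^bsub>M\<^esub>) = \<zero>\<^bsub>K\<^esub> \<odot>\<^bsub>N\<^esub> f \<zero>\<^bsub>M\<^esub>"
    using assms(3) by (intro linear_maps_smult) auto
  then show ?thesis
    using linear_maps_closed[OF assms(3)] by simp
qed

lemma linear_maps_minus:
  assumes "module K M" "module K N" "f \<in> linear_maps K M N" "x \<in> carrier M" "y \<in> carrier M"
  shows "f (x \<ominus>\<^bsub>M\<^esub> y) = f x \<ominus>\<^bsub>N\<^esub> f y"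
proof -
  interpret M: module K M by fact
  interpret N: module K N by fact
  have [simp]: "f x \<in> carrier N" "f y \<in> carrier N"
    using assms by (auto intro: linear_maps_closed)
  have "f x = f ((x \<ominus>\<^bsub>M\<^esub> y) \<oplus>\<^bsub>M\<^esub> y)"
    using assms(4,5) by (simp add: M.M.minus_eq M.M.a_assoc M.M.l_neg)
  also have "\<dots> = f (x \<ominus>\<^bsub>M\<^esub> y) \<oplus>\<^bsub>N\<^esub> f y"
    using assms(3-5) by (intro linear_maps_add) auto
  finally show ?thesis
    using linear_maps_closed[OF assms(3), of "x \<ominus>\<^bsub>M\<^esub> y"] assms(4,5)
    by (simp add: N.M.minus_eq N.M.a_assoc N.M.r_neg)
qed

lemma linear_maps_comp:
  "f \<in> linear_maps K M N \<Longrightarrow> g \<in> linear_maps K N P \<Longrightarrow> g \<circ> f \<in> linear_maps K M P"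
  by (auto simp: linear_maps_def Pi_iff)

lemma bilinear_mapD:
  assumes "bilinear_map K M N P f"
  shows bilinear_map_closed:
      "\<And>x y. \<lbrakk>x \<in> carrier M; y \<in> carrier N\<rbrakk> \<Longrightarrow> f x y \<in> carrier P"
    and bilinear_map_add_left:
      "\<And>x x' y. \<lbrakk>x \<in> carrier M; x' \<in> carrier M; y \<in> carrier N\<rbrakk> \<Longrightarrow>
        f (x \<oplus>\<^bsub>M\<^esub> x') y = f x y \<oplus>\<^bsub>P\<^esub> f x' y"
    and bilinear_map_add_right:
      "\<And>x y y'. \<lbrakk>x \<in> carrier M; y \<in> carrier N; y' \<in> carrier N\<rbrakk> \<Longrightarrow>
        f x (y \<oplus>\<^bsub>N\<^esub> y') = f x y \<oplus>\<^bsub>P\<^esub> f x y'"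
    and bilinear_map_smult_left:
      "\<And>c x y. \<lbrakk>c \<in> carrier K; x \<in> carrier M; y \<in> carrier N\<rbrakk> \<Longrightarrow> f (c \<odot>\<^bsub>M\<^esub> x) y = c \<odot>\<^bsub>P\<^esub> f x y"
    and bilinear_map_smult_right:
      "\<And>c x y. \<lbrakk>c \<in> carrier K; x \<in> carrier M; y \<in> carrier N\<rbrakk> \<Longrightarrow> f x (c \<odot>\<^bsub>N\<^esub> y) = c \<odot>\<^bsub>P\<^esub> f x y"
  using assms by (auto simp: bilinear_map_def linear_maps_def)

lemma bilinear_map_zero_left:
  assumes "bilinear_map K M N P f" "module K M" "module K P" "y \<in> carrier N"
  shows "f \<zero>\<^bsub>M\<^esub> y = \<zero>\<^bsub>P\<^esub>"
  using linear_maps_zero[of K M P "\<lambda>x. f x y"] assms by (auto simp: bilinear_map_def)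

lemma bilinear_map_zero_right:
  assumes "bilinear_map K M N P f" "module K N" "module K P" "x \<in> carrier M"
  shows "f x \<zero>\<^bsub>N\<^esub> = \<zero>\<^bsub>P\<^esub>"
  using linear_maps_zero[of K N P "f x"] assms by (auto simp: bilinear_map_def)

text \<open>By Zorn's lemma: a maximal subspace on which \<open>p\<close> is injective is mapped onto \<open>N\<close>.\<close>

lemma linear_section_exists:
  assumes K: "field K" and M: "module K M" and N: "module K N"
    and p: "p \<in> linear_maps K M N" and surj: "p ` carrier M = carrier N"
  shows "\<exists>s\<in>linear_maps K N M. \<forall>x\<in>carrier N. p (s x) = x"
proof -
  interpret K: field K by fact
  interpret M: module K M by fact
  interpret N: module K N by fact
  note [simp] = linear_mapsD[OF p] linear_maps_zero[OF M N p] linear_maps_minus[OF M N p]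
  \<comment> \<open>The last clause says that a subspace meets the kernel of \<open>p\<close> only
    in zero. For a subspace this is injectivity of \<open>p\<close>, and in this form it passes to
    unions of chains.\<close>
  define S where "S = {W. W \<subseteq> carrier M \<and> \<zero>\<^bsub>M\<^esub> \<in> W \<and> (\<forall>x\<in>W. \<forall>y\<in>W. x \<oplus>\<^bsub>M\<^esub> y \<in> W) \<and>
    (\<forall>c\<in>carrier K. \<forall>x\<in>W. c \<odot>\<^bsub>M\<^esub> x \<in> W) \<and> (\<forall>x\<in>W. p x = \<zero>\<^bsub>N\<^esub> \<longrightarrow> x = \<zero>\<^bsub>M\<^esub>)}"
  have "\<exists>W\<in>S. \<forall>X\<in>S. W \<subseteq> X \<longrightarrow> X = W"
  proof (rule subset_Zorn_nonempty)
    have "{\<zero>\<^bsub>M\<^esub>} \<in> S" by (auto simp: S_def)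
    then show "S \<noteq> {}" by blast
  next
    fix C assume C: "C \<noteq> {}" "subset.chain S C"
    have CS: "C \<subseteq> S" using C(2) by (simp add: subset.chain_def)
    have "x \<oplus>\<^bsub>M\<^esub> y \<in> \<Union>C" if xy: "x \<in> \<Union>C" "y \<in> \<Union>C" for x y
    proof -
      obtain X Y where XY: "X \<in> C" "x \<in> X" "Y \<in> C" "y \<in> Y" using xy by blast
      \<comment> \<open>The two summands come from possibly different members of the chain; the
        larger of these members contains both.\<close>
      have "X \<subseteq> Y \<or> Y \<subseteq> X" using C(2) XY by (auto simp: subset.chain_def)
      then obtain Z where Z: "Z \<in> C" "x \<in> Z" "y \<in> Z" using XY by blast
      then have "x \<oplus>\<^bsub>M\<^esub> y \<in> Z" using CS by (auto simp: S_def)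
      then show ?thesis using Z by blast
    qed
    moreover have "\<Union>C \<subseteq> carrier M" "\<zero>\<^bsub>M\<^esub> \<in> \<Union>C" "\<forall>c\<in>carrier K. \<forall>x\<in>\<Union>C. c \<odot>\<^bsub>M\<^esub> x \<in> \<Union>C"
      "\<forall>x\<in>\<Union>C. p x = \<zero>\<^bsub>N\<^esub> \<longrightarrow> x = \<zero>\<^bsub>M\<^esub>"
      using CS C(1) by (fastforce simp: S_def subset_iff)+
    ultimately show "\<Union>C \<in> S" by (simp add: S_def)
  qed
  then obtain W where WS: "W \<in> S" and max: "\<And>X. X \<in> S \<Longrightarrow> W \<subseteq> X \<Longrightarrow> X = W" by blast
  have Wsub: "\<And>w. w \<in> W \<Longrightarrow> w \<in> carrier M"
    and W0: "\<zero>\<^bsub>M\<^esub> \<in> W" and Wadd: "\<And>x y. x \<in> W \<Longrightarrow> y \<in> W \<Longrightarrow> x \<oplus>\<^bsub>M\<^esub> y \<in> W"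
    and Wsm: "\<And>c x. c \<in> carrier K \<Longrightarrow> x \<in> W \<Longrightarrow> c \<odot>\<^bsub>M\<^esub> x \<in> W"
    and Wker: "\<And>x. x \<in> W \<Longrightarrow> p x = \<zero>\<^bsub>N\<^esub> \<Longrightarrow> x = \<zero>\<^bsub>M\<^esub>"
    using WS by (auto simp: S_def)
  have Wneg: "\<ominus>\<^bsub>M\<^esub> x \<in> W" if "x \<in> W" for x
    using that Wsub[OF that] Wsm[of "\<ominus>\<^bsub>K\<^esub> \<one>\<^bsub>K\<^esub>" x] M.smult_l_minus[of "\<one>\<^bsub>K\<^esub>" x] by simp
  have inj: "x = y" if "x \<in> W" "y \<in> W" "p x = p y" for x y
  proof -
    have "x \<ominus>\<^bsub>M\<^esub> y \<in> W"
      unfolding M.M.minus_eq using that by (intro Wadd Wneg)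
    moreover have "p (x \<ominus>\<^bsub>M\<^esub> y) = \<zero>\<^bsub>N\<^esub>"
      using that Wsub by (simp add: N.M.minus_eq N.M.r_neg)
    ultimately have "x \<ominus>\<^bsub>M\<^esub> y = \<zero>\<^bsub>M\<^esub>"
      by (rule Wker)
    then show ?thesis
      using M.M.add_minus_cancel[of y x] that Wsub by simp
  qed
  have onto: "\<exists>w\<in>W. p w = x" if x: "x \<in> carrier N" for x
  proof (rule ccontr)
    assume no: "\<not> (\<exists>w\<in>W. p w = x)"
    obtain e where e: "e \<in> carrier M" "p e = x" using x surj by (metis imageE)
    \<comment> \<open>If \<open>x\<close> is not reached from \<open>W\<close>, the line through a
      preimage \<open>e\<close> of \<open>x\<close> can be added to \<open>W\<close>. The sum is
      still in \<open>S\<close>, so maximality puts \<open>e\<close> into \<open>W\<close>, a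
      contradiction.\<close>
    define X where "X = {w \<oplus>\<^bsub>M\<^esub> a \<odot>\<^bsub>M\<^esub> e | w a. w \<in> W \<and> a \<in> carrier K}"
    have XI: "w \<oplus>\<^bsub>M\<^esub> a \<odot>\<^bsub>M\<^esub> e \<in> X" if "w \<in> W" "a \<in> carrier K" for w a
      using that by (auto simp: X_def)
    have "W \<subseteq> X"
      using XI[of _ "\<zero>\<^bsub>K\<^esub>"] e Wsub by auto
    moreover have "e \<in> X"
      using XI[OF W0, of "\<one>\<^bsub>K\<^esub>"] e by simp
    moreover have "X \<in> S"
      unfolding S_def
    proof (intro CollectI conjI ballI impI)
      show "X \<subseteq> carrier M" using e Wsub by (auto simp: X_def)
      show "\<zero>\<^bsub>M\<^esub> \<in> X" using W0 \<open>W \<subseteq> X\<close> by blast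
    next
      fix u v assume "u \<in> X" "v \<in> X"
      then obtain w a w' a' where wa: "u = w \<oplus>\<^bsub>M\<^esub> a \<odot>\<^bsub>M\<^esub> e" "v = w' \<oplus>\<^bsub>M\<^esub> a' \<odot>\<^bsub>M\<^esub> e"
        "w \<in> W" "w' \<in> W" "a \<in> carrier K" "a' \<in> carrier K" by (auto simp: X_def)
      then have "u \<oplus>\<^bsub>M\<^esub> v = (w \<oplus>\<^bsub>M\<^esub> w') \<oplus>\<^bsub>M\<^esub> (a \<oplus>\<^bsub>K\<^esub> a') \<odot>\<^bsub>M\<^esub> e"
        using e Wsub by (simp add: M.smult_l_distr M.M.a_ac)
      then show "u \<oplus>\<^bsub>M\<^esub> v \<in> X" using XI wa Wadd by simp
    next
      fix c u assume c: "c \<in> carrier K" and "u \<in> X"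
      then obtain w a where wa: "u = w \<oplus>\<^bsub>M\<^esub> a \<odot>\<^bsub>M\<^esub> e" "w \<in> W" "a \<in> carrier K" by (auto simp: X_def)
      then have "c \<odot>\<^bsub>M\<^esub> u = c \<odot>\<^bsub>M\<^esub> w \<oplus>\<^bsub>M\<^esub> (c \<otimes>\<^bsub>K\<^esub> a) \<odot>\<^bsub>M\<^esub> e"
        using e Wsub c by (simp add: M.smult_r_distr M.smult_assoc1)
      then show "c \<odot>\<^bsub>M\<^esub> u \<in> X" using XI wa Wsm c by simp
    next
      fix u assume "u \<in> X" and pu: "p u = \<zero>\<^bsub>N\<^esub>"
      then obtain w a where wa: "u = w \<oplus>\<^bsub>M\<^esub> a \<odot>\<^bsub>M\<^esub> e" "w \<in> W" "a \<in> carrier K" by (auto simp: X_def)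
      show "u = \<zero>\<^bsub>M\<^esub>"
      proof (cases "a = \<zero>\<^bsub>K\<^esub>")
        case True
        then show ?thesis using wa pu e Wsub Wker by simp
      next
        case False
        \<comment> \<open>A kernel vector with nonzero coefficient \<open>a\<close> would allow
          division by \<open>a\<close>: then \<open>x\<close> is the image of
          \<open>- w / a\<close>, which lies in \<open>W\<close>, against the choice of
          \<open>x\<close>.\<close>
        then have a: "inv\<^bsub>K\<^esub> a \<in> carrier K" "inv\<^bsub>K\<^esub> a \<otimes>\<^bsub>K\<^esub> a = \<one>\<^bsub>K\<^esub>"
          using wa(3) K.field_Units by (auto intro: K.Units_inv_closed K.Units_l_inv)
        have cl: "p w \<in> carrier N" "w \<in> carrier M" using wa Wsub by auto
        have "p w \<oplus>\<^bsub>N\<^esub> a \<odot>\<^bsub>N\<^esub> x = \<zero>\<^bsub>N\<^esub>" using pu wa e cl by simp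
        then have "a \<odot>\<^bsub>N\<^esub> x = \<ominus>\<^bsub>N\<^esub> p w"
          using cl wa x N.M.minus_equality[of "a \<odot>\<^bsub>N\<^esub> x" "p w"] by (simp add: N.M.a_comm)
        then have "x = p (inv\<^bsub>K\<^esub> a \<odot>\<^bsub>M\<^esub> (\<ominus>\<^bsub>M\<^esub> w))"
          using cl a x wa N.smult_assoc1[of "inv\<^bsub>K\<^esub> a" a x] linear_maps_minus[OF M N p, of "\<zero>\<^bsub>M\<^esub>" w]
          by (simp add: M.M.minus_eq N.M.minus_eq)
        then show ?thesis using no Wsm[OF a(1) Wneg[OF wa(2)]] by blast
      qed
    qed
    ultimately have "e \<in> W" using max by blast
    then show False using no e by blast
  qed
  \<comment> \<open>The section inverts \<open>p\<close> on \<open>W\<close>. It is linear because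
    \<open>s_eq\<close> identifies its value as soon as some element of \<open>W\<close> with the
    right image is known, and \<open>W\<close> is closed under sums and scalar multiples.\<close>
  define s where "s = (\<lambda>x. THE w. w \<in> W \<and> p w = x)"
  have s: "s x \<in> W \<and> p (s x) = x" if "x \<in> carrier N" for x
    unfolding s_def by (rule theI') (use onto[OF that] inj in metis)
  have s_eq: "s x = w" if "w \<in> W" "p w = x" for x w
    using that s[of x] inj[of "s x" w] Wsub by auto
  have "s \<in> linear_maps K N M"
    unfolding linear_maps_def
  proof (intro CollectI conjI ballI)
    show "s \<in> carrier N \<rightarrow> carrier M" using s Wsub by blast
  next
    fix x y assume "x \<in> carrier N" "y \<in> carrier N"
    with s[of x] s[of y] show "s (x \<oplus>\<^bsub>N\<^esub> y) = s x \<oplus>\<^bsub>M\<^esub> s y"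
      by (intro s_eq Wadd) (simp_all add: Wsub)
  next
    fix a x assume "a \<in> carrier K" "x \<in> carrier N"
    with s[of x] show "s (a \<odot>\<^bsub>N\<^esub> x) = a \<odot>\<^bsub>M\<^esub> s x"
      by (intro s_eq Wsm) (simp_all add: Wsub)
  qed
  then show ?thesis using s by blast
qed

section \<open>Differential algebras and abelian extensions\<close>

context diff_algebra
begin

lemmas mult_rules = bilinear_mapD[OF mult_bilinear]
  bilinear_map_zero_left[OF mult_bilinear module_axioms module_axioms]
  bilinear_map_zero_right[OF mult_bilinear module_axioms module_axioms]

lemmas dop_rules = linear_mapsD[OF dop_linear] linear_maps_zero[OF module_axioms module_axioms dop_linear]

end

context diff_bimodule
begin

lemmas act_rules = bilinear_mapD[OF lact_bilinear]
  bilinear_map_zero_left[OF lact_bilinear module_axioms V.module_axioms]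
  bilinear_map_zero_right[OF lact_bilinear V.module_axioms V.module_axioms]
  bilinear_mapD[OF ract_bilinear]
  bilinear_map_zero_left[OF ract_bilinear V.module_axioms V.module_axioms]
  bilinear_map_zero_right[OF ract_bilinear module_axioms V.module_axioms]

lemmas dopV_rules = linear_mapsD[OF dopV_linear]
  linear_maps_zero[OF V.module_axioms V.module_axioms dopV_linear]

end

text \<open>
  The minimum to require of a bare record for the axioms to be pulled back to it along an injection.
\<close>

definition closed_structure ::
  "('k, 'm) ring_scheme \<Rightarrow> ('k, 'a, 'r) diff_module_scheme \<Rightarrow> bool"
  where "closed_structure K B \<longleftrightarrow> \<zero>\<^bsub>B\<^esub> \<in> carrier B \<and>
    (\<forall>x\<in>carrier B. \<forall>y\<in>carrier B. x \<oplus>\<^bsub>B\<^esub> y \<in> carrier B \<and> x \<otimes>\<^bsub>B\<^esub> y \<in> carrier B) \<and>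
    (\<forall>c\<in>carrier K. \<forall>x\<in>carrier B. c \<odot>\<^bsub>B\<^esub> x \<in> carrier B) \<and>
    (\<forall>x\<in>carrier B. dop B x \<in> carrier B)"

section \<open>Pulling the axioms back along a bijection\<close>

lemma diff_homD:
  assumes "h \<in> diff_hom K B C"
  shows diff_hom_linear: "h \<in> linear_maps K B C"
    and diff_hom_mult:
      "\<And>x y. \<lbrakk>x \<in> carrier B; y \<in> carrier B\<rbrakk> \<Longrightarrow> h (x \<otimes>\<^bsub>B\<^esub> y) = h x \<otimes>\<^bsub>C\<^esub> h y"
    and diff_hom_dop: "\<And>x. x \<in> carrier B \<Longrightarrow> h (dop B x) = dop C (h x)"
  using assms by (auto simp: diff_hom_def)

text \<open>The equational axioms are checked after applying the injective map \<open>h\<close>,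
  where they become axioms of \<open>C\<close>. Surjectivity serves the two axioms of another shape:
  existence of negatives and the condition on identity elements. The value of \<open>h\<close> at
  zero is a hypothesis because \<open>B\<close> is not yet known to be a group.\<close>

lemma diff_algebra_transfer:
  fixes B :: "('k, 'b, 'r) diff_module_scheme" and C :: "('k, 'c, 's) diff_module_scheme"
  assumes C: "diff_algebra K lam C" and lam: "lam \<in> carrier K"
    and B: "closed_structure K B" and h: "h \<in> diff_hom K B C"
    and bij: "bij_betw h (carrier B) (carrier C)" and zero: "h \<zero>\<^bsub>B\<^esub> = \<zero>\<^bsub>C\<^esub>"
  shows "diff_algebra K lam B"
proof -
  interpret C: diff_algebra K lam C by fact
  have cl [simp]: "\<zero>\<^bsub>B\<^esub> \<in> carrier B"
    "\<And>x y. x \<in> carrier B \<Longrightarrow> y \<in> carrier B \<Longrightarrow> x \<oplus>\<^bsub>B\<^esub> y \<in> carrier B"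
    "\<And>x y. x \<in> carrier B \<Longrightarrow> y \<in> carrier B \<Longrightarrow> x \<otimes>\<^bsub>B\<^esub> y \<in> carrier B"
    "\<And>c x. c \<in> carrier K \<Longrightarrow> x \<in> carrier B \<Longrightarrow> c \<odot>\<^bsub>B\<^esub> x \<in> carrier B"
    "\<And>x. x \<in> carrier B \<Longrightarrow> dop B x \<in> carrier B"
    using B by (auto simp: closed_structure_def)
  note [simp] = linear_mapsD[OF diff_hom_linear[OF h]] diff_hom_mult[OF h] diff_hom_dop[OF h]
    zero lam C.mult_rules C.dop_rules
  have inj: "x = y" if "h x = h y" "x \<in> carrier B" "y \<in> carrier B" for x y
    using that bij by (auto simp: bij_betw_def inj_on_def)
  have neg: "\<exists>y\<in>carrier B. y \<oplus>\<^bsub>B\<^esub> x = \<zero>\<^bsub>B\<^esub>" if x: "x \<in> carrier B" for x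
  proof -
    obtain y where y: "y \<in> carrier B" "h y = \<ominus>\<^bsub>C\<^esub> h x"
      using bij x C.M.a_inv_closed[of "h x"]
      by (metis bij_betw_imp_surj_on imageE linear_maps_closed[OF diff_hom_linear[OF h]])
    then have "y \<oplus>\<^bsub>B\<^esub> x = \<zero>\<^bsub>B\<^esub>"
      using x by (intro inj) (auto simp: C.M.l_neg)
    then show ?thesis using y by blast
  qed
  have ag: "abelian_group B"
    by (rule abelian_groupI) (auto intro!: inj neg simp: C.M.a_ac)
  have mod: "module K B"
    by (rule moduleI)
      (auto intro!: inj C.cring_axioms ag simp: C.smult_l_distr C.smult_r_distr C.smult_assoc1)
  show ?thesis
  proof (intro diff_algebra.intro diff_algebra_axioms.intro)
    show "field K" by (rule C.field_axioms)
    show "module K B" by (rule mod)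
    show "bilinear_map K B B B (\<lambda>x y. x \<otimes>\<^bsub>B\<^esub> y)"
      by (auto simp: bilinear_map_def linear_maps_def intro!: inj)
    show "dop B \<in> linear_maps K B B"
      by (auto simp: linear_maps_def intro!: inj)
  next
    fix x y z assume "x \<in> carrier B" "y \<in> carrier B" "z \<in> carrier B"
    then show "x \<otimes>\<^bsub>B\<^esub> y \<otimes>\<^bsub>B\<^esub> z = x \<otimes>\<^bsub>B\<^esub> (y \<otimes>\<^bsub>B\<^esub> z)"
      by (auto intro!: inj simp: C.mult_assoc)
  next
    fix x y assume "x \<in> carrier B" "y \<in> carrier B"
    then show "dop B (x \<otimes>\<^bsub>B\<^esub> y) =
        dop B x \<otimes>\<^bsub>B\<^esub> y \<oplus>\<^bsub>B\<^esub> x \<otimes>\<^bsub>B\<^esub> dop B y \<oplus>\<^bsub>B\<^esub> lam \<odot>\<^bsub>B\<^esub> (dop B x \<otimes>\<^bsub>B\<^esub> dop B y)"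
      by (auto intro!: inj simp: C.dop_mult)
  next
    fix e assume e: "e \<in> carrier B" "\<forall>x\<in>carrier B. e \<otimes>\<^bsub>B\<^esub> x = x \<and> x \<otimes>\<^bsub>B\<^esub> e = x"
    \<comment> \<open>As \<open>h\<close> is onto, it carries an identity element of
      \<open>B\<close> to an identity element of \<open>C\<close>, which the operator of
      \<open>C\<close> kills.\<close>
    have "h e \<otimes>\<^bsub>C\<^esub> y = y \<and> y \<otimes>\<^bsub>C\<^esub> h e = y" if y: "y \<in> carrier C" for y
    proof -
      obtain x where "x \<in> carrier B" "y = h x"
        using bij y by (auto simp: bij_betw_def)
      then show ?thesis using e diff_hom_mult[OF h, of e x] diff_hom_mult[OF h, of x e] by simp
    qed
    then have "dop C (h e) = \<zero>\<^bsub>C\<^esub>" using e by (intro C.dop_unit) auto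
    then show "dop B e = \<zero>\<^bsub>B\<^esub>" using e by (auto intro!: inj)
  qed
qed

lemma (in diff_algebra) closed_structure: "closed_structure K A"
  by (auto simp: closed_structure_def mult_rules dop_rules)

section \<open>Abelian extensions and their isomorphisms\<close>

lemma abelian_extensionD:
  assumes "abelian_extension K lam A V E"
  shows ext_diff_algebra: "diff_algebra K lam (ext_alg E)"
    and incl_hom: "incl E \<in> diff_hom K (zero_product V) (ext_alg E)"
    and proj_hom: "proj E \<in> diff_hom K (ext_alg E) A"
    and incl_inj: "inj_on (incl E) (carrier V)"
    and incl_image: "incl E ` carrier V = {e \<in> carrier (ext_alg E). proj E e = \<zero>\<^bsub>A\<^esub>}"
    and proj_image: "proj E ` carrier (ext_alg E) = carrier A"
  using assms by (auto simp: abelian_extension_def)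

lemma zero_product_simps [simp]:
  "carrier (zero_product V) = carrier V" "add (zero_product V) = add V"
  "zero (zero_product V) = zero V" "smult (zero_product V) = smult V"
  "dop (zero_product V) = dop V" "u \<otimes>\<^bsub>zero_product V\<^esub> v = \<zero>\<^bsub>V\<^esub>"
  by (simp_all add: zero_product_def)

lemma linear_maps_zero_product [simp]: "linear_maps K (zero_product V) M = linear_maps K V M"
  by (simp add: linear_maps_def)

text \<open>Unfolds \<open>zero_product\<close> in the homomorphism laws of the inclusion. The
  product is left as the image of zero, since \<open>V\<close> is a bare record here and the step
  from that image to the zero of the extension uses the module laws.\<close>

lemma incl_simps:
  assumes "abelian_extension K lam A V E"
  shows incl_linear: "incl E \<in> linear_maps K V (ext_alg E)"
    and incl_mult: "\<And>u v. \<lbrakk>u \<in> carrier V; v \<in> carrier V\<rbrakk> \<Longrightarrow>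
      incl E u \<otimes>\<^bsub>ext_alg E\<^esub> incl E v = incl E \<zero>\<^bsub>V\<^esub>"
    and incl_dop: "\<And>v. v \<in> carrier V \<Longrightarrow> dop (ext_alg E) (incl E v) = incl E (dop V v)"
proof -
  note h = diff_homD[OF incl_hom[OF assms], unfolded zero_product_simps linear_maps_zero_product]
  show "incl E \<in> linear_maps K V (ext_alg E)" by (rule h(1))
  show "incl E u \<otimes>\<^bsub>ext_alg E\<^esub> incl E v = incl E \<zero>\<^bsub>V\<^esub>" if "u \<in> carrier V" "v \<in> carrier V" for u v
    using h(2)[OF that] by (rule sym)
  show "dop (ext_alg E) (incl E v) = incl E (dop V v)" if "v \<in> carrier V" for v
    using h(3)[OF that] by (rule sym)
qed

lemma sections_nonempty:
  assumes "diff_algebra K lam A" "abelian_extension K lam A V E"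
  shows "sections K A E \<noteq> {}"
proof -
  interpret A: diff_algebra K lam A by fact
  interpret B: diff_algebra K lam "ext_alg E" using assms(2) by (rule ext_diff_algebra)
  show ?thesis
    using linear_section_exists[OF A.field_axioms B.module_axioms A.module_axioms
        diff_hom_linear[OF proj_hom[OF assms(2)]] proj_image[OF assms(2)]]
    by (auto simp: sections_def)
qed

lemma diff_hom_comp:
  assumes "f \<in> diff_hom K A B" "g \<in> diff_hom K B C"
  shows "g \<circ> f \<in> diff_hom K A C"
  using assms linear_maps_comp[of f K A B g C]
  by (auto simp: diff_hom_def linear_maps_def Pi_iff)

lemma diff_hom_inverse:
  assumes B: "closed_structure K B" and h: "h \<in> diff_hom K B C"
    and bij: "bij_betw h (carrier B) (carrier C)"
  shows "inv_into (carrier B) h \<in> diff_hom K C B"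
proof -
  let ?k = "inv_into (carrier B) h"
  have k: "?k y \<in> carrier B" "h (?k y) = y" if "y \<in> carrier C" for y
    using that bij bij_betw_inv_into_right[OF bij] bij_betwE[OF bij_betw_inv_into[OF bij]] by auto
  have eq: "?k y = x" if "x \<in> carrier B" "h x = y" for x y
    using that bij_betw_inv_into_left[OF bij] by auto
  note hs = linear_mapsD[OF diff_hom_linear[OF h]] diff_hom_mult[OF h] diff_hom_dop[OF h]
  show ?thesis
    using B unfolding closed_structure_def
    by (auto simp: diff_hom_def linear_maps_def k hs intro!: eq)
qed

lemma isomorphic_extensionsI:
  assumes "\<zeta> \<in> diff_hom K (ext_alg E1) (ext_alg E2)"
    "bij_betw \<zeta> (carrier (ext_alg E1)) (carrier (ext_alg E2))"
    "\<And>v. v \<in> carrier V \<Longrightarrow> \<zeta> (incl E1 v) = incl E2 v"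
    "\<And>e. e \<in> carrier (ext_alg E1) \<Longrightarrow> proj E2 (\<zeta> e) = proj E1 e"
  shows "isomorphic_extensions K V E1 E2"
  using assms unfolding isomorphic_extensions_def by blast

lemma isomorphic_extensions_trans:
  assumes "isomorphic_extensions K V E1 E2" "isomorphic_extensions K V E2 E3"
  shows "isomorphic_extensions K V E1 E3"
proof -
  obtain \<zeta> where z: "\<zeta> \<in> diff_hom K (ext_alg E1) (ext_alg E2)"
    "bij_betw \<zeta> (carrier (ext_alg E1)) (carrier (ext_alg E2))"
    "\<forall>v\<in>carrier V. \<zeta> (incl E1 v) = incl E2 v"
    "\<forall>e\<in>carrier (ext_alg E1). proj E2 (\<zeta> e) = proj E1 e"
    using assms(1) unfolding isomorphic_extensions_def by blast
  obtain \<xi> where x: "\<xi> \<in> diff_hom K (ext_alg E2) (ext_alg E3)"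
    "bij_betw \<xi> (carrier (ext_alg E2)) (carrier (ext_alg E3))"
    "\<forall>v\<in>carrier V. \<xi> (incl E2 v) = incl E3 v"
    "\<forall>e\<in>carrier (ext_alg E2). proj E3 (\<xi> e) = proj E2 e"
    using assms(2) unfolding isomorphic_extensions_def by blast
  show ?thesis
    using z x
    by (intro isomorphic_extensionsI[of "\<xi> \<circ> \<zeta>"])
      (auto intro: diff_hom_comp bij_betw_trans dest: bij_betw_apply)
qed

text \<open>The inverse bijection is again a homomorphism over the identities of \<open>V\<close>
  and \<open>A\<close>. The closure assumptions ensure that the operations and the inclusion of
  \<open>E1\<close> yield elements of its carrier, where \<open>inv_into\<close> undoes the
  isomorphism.\<close>

lemma isomorphic_extensions_sym:
  assumes iso: "isomorphic_extensions K V E1 E2" and cl: "closed_structure K (ext_alg E1)"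
    and incl: "incl E1 \<in> carrier V \<rightarrow> carrier (ext_alg E1)"
  shows "isomorphic_extensions K V E2 E1"
proof -
  obtain \<zeta> where z: "\<zeta> \<in> diff_hom K (ext_alg E1) (ext_alg E2)"
    "bij_betw \<zeta> (carrier (ext_alg E1)) (carrier (ext_alg E2))"
    "\<forall>v\<in>carrier V. \<zeta> (incl E1 v) = incl E2 v"
    "\<forall>e\<in>carrier (ext_alg E1). proj E2 (\<zeta> e) = proj E1 e"
    using iso unfolding isomorphic_extensions_def by blast
  let ?k = "inv_into (carrier (ext_alg E1)) \<zeta>"
  show ?thesis
  proof (rule isomorphic_extensionsI)
    show "?k \<in> diff_hom K (ext_alg E2) (ext_alg E1)" by (rule diff_hom_inverse[OF cl z(1,2)])
    show "bij_betw ?k (carrier (ext_alg E2)) (carrier (ext_alg E1))"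
      by (rule bij_betw_inv_into[OF z(2)])
  next
    fix v assume "v \<in> carrier V"
    then show "?k (incl E2 v) = incl E1 v"
      using z(3) bij_betw_inv_into_left[OF z(2), of "incl E1 v"] incl by (auto simp: Pi_iff)
  next
    fix e assume "e \<in> carrier (ext_alg E2)"
    then show "proj E1 (?k e) = proj E2 e"
      using z(4) bij_betw_inv_into_right[OF z(2), of e]
        bij_betwE[OF bij_betw_inv_into[OF z(2)]] by fastforce
  qed
qed

lemma abelian_extensions_sym:
  assumes "E1 \<in> abelian_extensions K lam A V" "isomorphic_extensions K V E1 E2"
  shows "isomorphic_extensions K V E2 E1"
proof (rule isomorphic_extensions_sym[OF assms(2)])
  have E: "abelian_extension K lam A V E1"
    using assms(1) by (simp add: abelian_extensions_def)
  then interpret B: diff_algebra K lam "ext_alg E1" by (rule ext_diff_algebra)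
  show "closed_structure K (ext_alg E1)" by (rule B.closed_structure)
  show "incl E1 \<in> carrier V \<rightarrow> carrier (ext_alg E1)"
    using linear_maps_closed[OF incl_linear[OF E]] by auto
qed

lemma isomorphic_extensions_refl: "isomorphic_extensions K V E E"
  by (rule isomorphic_extensionsI[of id]) (auto simp: diff_hom_def linear_maps_def)

text \<open>Transport of structure to a record \<open>E1\<close> that is not yet known to be an
  extension, or even an algebra: each equation is checked in \<open>E2\<close> through an injective
  map. It serves for twisted sums whose pair is not yet known to be a cocycle, and for copies of an
  extension on another carrier.\<close>

lemma abelian_extensions_transfer:
  fixes E1 :: "('k, 'a, 'v, 'e) extension" and E2 :: "('k, 'a, 'v, 'f) extension"
  assumes V: "diff_bimodule K lam A V" and lam: "lam \<in> carrier K"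
    and E2: "E2 \<in> abelian_extensions K lam A V"
    and cl: "closed_structure K (ext_alg E1)" "incl E1 \<in> carrier V \<rightarrow> carrier (ext_alg E1)"
      "incl E1 \<zero>\<^bsub>V\<^esub> = \<zero>\<^bsub>ext_alg E1\<^esub>"
    and iso: "isomorphic_extensions K V E1 E2"
  shows "E1 \<in> abelian_extensions K lam A V"
proof -
  interpret diff_bimodule K lam A V by fact
  have ab2: "abelian_extension K lam A V E2" and ind2: "induces_bimodule K A V E2"
    using E2 by (auto simp: abelian_extensions_def)
  interpret B: diff_algebra K lam "ext_alg E2" using ab2 by (rule ext_diff_algebra)
  obtain h where h: "h \<in> diff_hom K (ext_alg E1) (ext_alg E2)"
    and bij: "bij_betw h (carrier (ext_alg E1)) (carrier (ext_alg E2))"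
    and hi: "\<forall>v\<in>carrier V. h (incl E1 v) = incl E2 v"
    and hp: "\<forall>e\<in>carrier (ext_alg E1). proj E2 (h e) = proj E1 e"
    using iso unfolding isomorphic_extensions_def by blast
  note hs = linear_mapsD[OF diff_hom_linear[OF h]] diff_hom_mult[OF h] diff_hom_dop[OF h]
  have inj: "x = y" if "h x = h y" "x \<in> carrier (ext_alg E1)" "y \<in> carrier (ext_alg E1)" for x y
    using that bij by (auto simp: bij_betw_def inj_on_def)
  have im: "h ` carrier (ext_alg E1) = carrier (ext_alg E2)"
    using bij by (simp add: bij_betw_def)
  have i2: "incl E2 \<zero>\<^bsub>V\<^esub> = \<zero>\<^bsub>ext_alg E2\<^esub>"
    by (rule linear_maps_zero[OF V.module_axioms B.module_axioms incl_linear[OF ab2]])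
  have h0: "h \<zero>\<^bsub>ext_alg E1\<^esub> = \<zero>\<^bsub>ext_alg E2\<^esub>"
    using hi i2 cl(3) V.zero_closed by metis
  have iV: "\<And>v. v \<in> carrier V \<Longrightarrow> incl E1 v \<in> carrier (ext_alg E1)" using cl(2) by auto
  have c: "\<And>x y. x \<in> carrier (ext_alg E1) \<Longrightarrow> y \<in> carrier (ext_alg E1) \<Longrightarrow> x \<oplus>\<^bsub>ext_alg E1\<^esub> y \<in> carrier (ext_alg E1)"
    "\<And>x y. x \<in> carrier (ext_alg E1) \<Longrightarrow> y \<in> carrier (ext_alg E1) \<Longrightarrow> x \<otimes>\<^bsub>ext_alg E1\<^esub> y \<in> carrier (ext_alg E1)"
    "\<And>c x. c \<in> carrier K \<Longrightarrow> x \<in> carrier (ext_alg E1) \<Longrightarrow> c \<odot>\<^bsub>ext_alg E1\<^esub> x \<in> carrier (ext_alg E1)"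
    "\<And>x. x \<in> carrier (ext_alg E1) \<Longrightarrow> dop (ext_alg E1) x \<in> carrier (ext_alg E1)"
    using cl(1) by (auto simp: closed_structure_def)
  note incl_rules = linear_mapsD[OF incl_linear[OF ab2]] incl_mult[OF ab2] incl_dop[OF ab2]
  note ps = linear_mapsD[OF diff_hom_linear[OF proj_hom[OF ab2]]] diff_hom_mult[OF proj_hom[OF ab2]]
    diff_hom_dop[OF proj_hom[OF ab2]]
  have pr: "proj E1 e = proj E2 (h e)" if "e \<in> carrier (ext_alg E1)" for e
    using hp that by simp
  have "abelian_extension K lam A V E1"
    unfolding abelian_extension_def
  proof (intro conjI)
    show "diff_algebra K lam (ext_alg E1)"
      by (rule diff_algebra_transfer[OF B.diff_algebra_axioms lam cl(1) h bij h0])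
    show "incl E1 \<in> diff_hom K (zero_product V) (ext_alg E1)"
      by (auto simp: diff_hom_def linear_maps_def iV c hs hi incl_rules dopV_rules intro!: inj)
    show "proj E1 \<in> diff_hom K (ext_alg E1) A"
      by (auto simp: diff_hom_def linear_maps_def c hs pr ps)
    show "inj_on (incl E1) (carrier V)"
      using incl_inj[OF ab2] hi by (metis inj_on_def)
    show "incl E1 ` carrier V = {e \<in> carrier (ext_alg E1). proj E1 e = \<zero>\<^bsub>A\<^esub>}"
    proof (intro equalityI subsetI)
      fix e assume "e \<in> incl E1 ` carrier V"
      then show "e \<in> {e \<in> carrier (ext_alg E1). proj E1 e = \<zero>\<^bsub>A\<^esub>}"
        using incl_image[OF ab2] iV hi by (auto simp: pr)
    next
      fix e assume "e \<in> {e \<in> carrier (ext_alg E1). proj E1 e = \<zero>\<^bsub>A\<^esub>}"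
      then have e: "e \<in> carrier (ext_alg E1)" "proj E2 (h e) = \<zero>\<^bsub>A\<^esub>" by (auto simp: pr)
      then have "h e \<in> incl E2 ` carrier V" using incl_image[OF ab2] by (auto simp: hs)
      then obtain v where "v \<in> carrier V" "h e = h (incl E1 v)" using hi by auto
      then show "e \<in> incl E1 ` carrier V" using e iV inj by blast
    qed
    show "proj E1 ` carrier (ext_alg E1) = carrier A"
      using proj_image[OF ab2] hp im by (metis image_cong image_image)
  qed
  moreover have "induces_bimodule K A V E1"
    unfolding induces_bimodule_def
  proof (intro ballI)
    fix s x v assume s: "s \<in> sections K A E1" and x: "x \<in> carrier A" and v: "v \<in> carrier V"
    have sl: "s \<in> linear_maps K A (ext_alg E1)" and sp: "\<forall>x\<in>carrier A. proj E1 (s x) = x"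
      using s by (auto simp: sections_def)
    \<comment> \<open>A section of \<open>E1\<close> becomes a section of \<open>E2\<close> when
      followed by \<open>h\<close>, so the known actions in \<open>E2\<close> determine its products
      with elements of \<open>V\<close>.\<close>
    have "h \<circ> s \<in> sections K A E2"
      using linear_maps_comp[OF sl diff_hom_linear[OF h]] sp linear_maps_closed[OF sl]
      by (auto simp: sections_def pr)
    then have "incl E2 (lact V x v) = h (s x) \<otimes>\<^bsub>ext_alg E2\<^esub> incl E2 v \<and>
       incl E2 (ract V v x) = incl E2 v \<otimes>\<^bsub>ext_alg E2\<^esub> h (s x)"
      using ind2 x v unfolding induces_bimodule_def by fastforce
    then show "incl E1 (lact V x v) = s x \<otimes>\<^bsub>ext_alg E1\<^esub> incl E1 v \<and>
       incl E1 (ract V v x) = incl E1 v \<otimes>\<^bsub>ext_alg E1\<^esub> s x"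
      using x v by (auto simp: act_rules iV c hs hi linear_maps_closed[OF sl] intro!: inj)
  qed
  ultimately show ?thesis by (simp add: abelian_extensions_def)
qed

section \<open>Twisted sums\<close>

text \<open>For the zero pair this is the square-zero extension of \<open>A\<close> by the bimodule
  \<open>V\<close>. The pair is left arbitrary so that the cocycle conditions can be read off from
  the algebra axioms. The field \<open>one\<close> gets a dummy value because algebras need not be
  unital.\<close>

definition twisted_sum ::
  "('k, 'a, 'r) diff_module_scheme \<Rightarrow> ('k, 'v, 'a, 's) diff_bimod_scheme \<Rightarrow>
   ('a \<times> 'a \<Rightarrow> 'v) \<times> ('a \<Rightarrow> 'v) \<Rightarrow> ('k, 'a, 'v, 'a \<times> 'v) extension"
  where "twisted_sum A V c = \<lparr>
    ext_alg = \<lparr>carrier = carrier A \<times> carrier V,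
      mult = (\<lambda>(x, u) (y, v). (x \<otimes>\<^bsub>A\<^esub> y, lact V x v \<oplus>\<^bsub>V\<^esub> ract V u y \<oplus>\<^bsub>V\<^esub> fst c (x, y))),
      one = undefined,
      zero = (\<zero>\<^bsub>A\<^esub>, \<zero>\<^bsub>V\<^esub>),
      add = (\<lambda>(x, u) (y, v). (x \<oplus>\<^bsub>A\<^esub> y, u \<oplus>\<^bsub>V\<^esub> v)),
      smult = (\<lambda>a (x, u). (a \<odot>\<^bsub>A\<^esub> x, a \<odot>\<^bsub>V\<^esub> u)),
      dop = (\<lambda>(x, u). (dop A x, dop V u \<oplus>\<^bsub>V\<^esub> snd c x))\<rparr>,
    incl = (\<lambda>v. (\<zero>\<^bsub>A\<^esub>, v)),
    proj = fst\<rparr>"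

lemma twisted_sum_simps [simp]:
  "carrier (ext_alg (twisted_sum A V c)) = carrier A \<times> carrier V"
  "(x, u) \<otimes>\<^bsub>ext_alg (twisted_sum A V c)\<^esub> (y, v) =
    (x \<otimes>\<^bsub>A\<^esub> y, lact V x v \<oplus>\<^bsub>V\<^esub> ract V u y \<oplus>\<^bsub>V\<^esub> fst c (x, y))"
  "\<zero>\<^bsub>ext_alg (twisted_sum A V c)\<^esub> = (\<zero>\<^bsub>A\<^esub>, \<zero>\<^bsub>V\<^esub>)"
  "(x, u) \<oplus>\<^bsub>ext_alg (twisted_sum A V c)\<^esub> (y, v) = (x \<oplus>\<^bsub>A\<^esub> y, u \<oplus>\<^bsub>V\<^esub> v)"
  "a \<odot>\<^bsub>ext_alg (twisted_sum A V c)\<^esub> (x, u) = (a \<odot>\<^bsub>A\<^esub> x, a \<odot>\<^bsub>V\<^esub> u)"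
  "dop (ext_alg (twisted_sum A V c)) (x, u) = (dop A x, dop V u \<oplus>\<^bsub>V\<^esub> snd c x)"
  "incl (twisted_sum A V c) v = (\<zero>\<^bsub>A\<^esub>, v)"
  "proj (twisted_sum A V c) = fst"
  by (simp_all add: twisted_sum_def)

text \<open>Membership of \<open>lam\<close> in the field keeps the terms scaled by it inside
  \<open>A\<close> and \<open>V\<close>; \<open>diff_bimodule\<close> alone does not provide
  it.\<close>

locale weighted_bimodule = diff_bimodule K lam A V
  for K :: "('k, 'm) ring_scheme" (structure) and lam :: 'k
    and A :: "('k, 'a, 'r) diff_module_scheme"
    and V :: "('k, 'v, 'a, 's) diff_bimod_scheme" +
  assumes lam_closed [simp]: "lam \<in> carrier K"
begin

section \<open>Cocycle conditions as axioms of the twisted sum\<close>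

lemma eq_iff_minus_zero:
  "\<lbrakk>p \<in> carrier V; q \<in> carrier V\<rbrakk> \<Longrightarrow> p \<ominus>\<^bsub>V\<^esub> q = \<zero>\<^bsub>V\<^esub> \<longleftrightarrow> p = q"
  by (metis V.minus_eq V.minus_equality V.minus_minus V.r_neg V.a_inv_closed)

text \<open>The two sides are the \<open>V\<close>-components of \<open>p (q r)\<close> and
  \<open>(p q) r\<close> for \<open>p = (x, 0)\<close>, \<open>q = (y, 0)\<close>,
  \<open>r = (z, 0)\<close> in the twisted sum, up to the order of summands. The map
  \<open>f\<close> is arbitrary because its bilinearity is itself to be derived from the twisted
  sum.\<close>

lemma hoch_d2_eq_zero_iff:
  assumes f: "f \<in> carrier A \<times> carrier A \<rightarrow> carrier V"
    and xyz: "x \<in> carrier A" "y \<in> carrier A" "z \<in> carrier A"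
  shows "hoch_d2 A V f x y z = \<zero>\<^bsub>V\<^esub> \<longleftrightarrow>
    lact V x (f (y, z)) \<oplus>\<^bsub>V\<^esub> f (x, y \<otimes>\<^bsub>A\<^esub> z) = f (x \<otimes>\<^bsub>A\<^esub> y, z) \<oplus>\<^bsub>V\<^esub> ract V (f (x, y)) z"
    (is "_ \<longleftrightarrow> ?p = ?q")
proof -
  have cl [simp]: "f (x, y) \<in> carrier V" if "x \<in> carrier A" "y \<in> carrier A" for x y
    using f that by auto
  note [simp] = act_rules mult_rules
  have "hoch_d2 A V f x y z = ?p \<ominus>\<^bsub>V\<^esub> ?q"
    unfolding hoch_d2_def using xyz by (simp add: V.minus_eq V.minus_add V.a_ac)
  moreover have "?p \<in> carrier V" "?q \<in> carrier V"
    using xyz by simp_all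
  ultimately show ?thesis by (simp add: eq_iff_minus_zero)
qed

text \<open>This is the weighted Leibniz rule for \<open>(x, 0)\<close> and \<open>(y, 0)\<close> in
  the twisted sum, read in the \<open>V\<close>-component: the left side collects the three terms of
  the rule, the right side is the operator applied to the product.\<close>

lemma cocycle_dop_iff:
  assumes f: "f \<in> carrier A \<times> carrier A \<rightarrow> carrier V" and g: "g \<in> carrier A \<rightarrow> carrier V"
    and xy: "x \<in> carrier A" "y \<in> carrier A"
  shows "hoch_d1_lam lam A V g x y \<oplus>\<^bsub>V\<^esub> delta2 lam A V f x y = \<zero>\<^bsub>V\<^esub> \<longleftrightarrow>
    ract V (g x) y \<oplus>\<^bsub>V\<^esub> f (dop A x, y) \<oplus>\<^bsub>V\<^esub> (lact V x (g y) \<oplus>\<^bsub>V\<^esub> f (x, dop A y)) \<oplus>\<^bsub>V\<^esub>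
      lam \<odot>\<^bsub>V\<^esub> (lact V (dop A x) (g y) \<oplus>\<^bsub>V\<^esub> ract V (g x) (dop A y) \<oplus>\<^bsub>V\<^esub> f (dop A x, dop A y)) =
    dop V (f (x, y)) \<oplus>\<^bsub>V\<^esub> g (x \<otimes>\<^bsub>A\<^esub> y)"
    (is "_ \<longleftrightarrow> ?p = ?q")
proof -
  have cl [simp]: "f (x, y) \<in> carrier V" if "x \<in> carrier A" "y \<in> carrier A" for x y
    using f that by auto
  have [simp]: "g x \<in> carrier V" if "x \<in> carrier A" for x
    using g that by auto
  note [simp] = act_rules mult_rules dop_rules dopV_rules
  have "hoch_d1_lam lam A V g x y \<oplus>\<^bsub>V\<^esub> delta2 lam A V f x y = ?p \<ominus>\<^bsub>V\<^esub> ?q"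
    unfolding hoch_d1_lam_def delta2_def lam_lact_def lam_ract_def
    using xy by (simp add: V.minus_eq V.minus_add V.a_ac V.smult_r_distr)
  moreover have "?p \<in> carrier V" "?q \<in> carrier V"
    using xy by simp_all
  ultimately show ?thesis by (simp add: eq_iff_minus_zero)
qed

lemma cocycles2_iff:
  "c \<in> cocycles2 K lam A V \<longleftrightarrow>
    fst c \<in> extensional (carrier A \<times> carrier A) \<and> snd c \<in> extensional (carrier A) \<and>
    bilinear_map K A A V (\<lambda>x y. fst c (x, y)) \<and> snd c \<in> linear_maps K A V \<and>
    (\<forall>x\<in>carrier A. \<forall>y\<in>carrier A. \<forall>z\<in>carrier A. hoch_d2 A V (fst c) x y z = \<zero>\<^bsub>V\<^esub>) \<and>
    (\<forall>x\<in>carrier A. \<forall>y\<in>carrier A.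
      hoch_d1_lam lam A V (snd c) x y \<oplus>\<^bsub>V\<^esub> delta2 lam A V (fst c) x y = \<zero>\<^bsub>V\<^esub>)"
  by (cases c) (auto simp: cocycles2_def Hom1_def Hom2_def)

lemma cocycles2_funcset:
  assumes "c \<in> cocycles2 K lam A V"
  shows "fst c \<in> (carrier A \<times> carrier A) \<rightarrow>\<^sub>E carrier V" "snd c \<in> carrier A \<rightarrow>\<^sub>E carrier V"
  using assms unfolding cocycles2_iff
  by (auto simp: PiE_def dest: linear_maps_closed bilinear_map_closed)

text \<open>On elements \<open>(x, 0)\<close> the module actions contribute little beyond the twist.
  Distributivity and compatibility with scalars then give bilinearity of the first map, linearity of
  the operator gives linearity of the second, and associativity and the Leibniz rule give the two
  cocycle conditions.\<close>

lemma twisted_sum_cocycle: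
  assumes alg: "diff_algebra K lam (ext_alg (twisted_sum A V c))"
    and f: "fst c \<in> (carrier A \<times> carrier A) \<rightarrow>\<^sub>E carrier V" and g: "snd c \<in> carrier A \<rightarrow>\<^sub>E carrier V"
  shows "c \<in> cocycles2 K lam A V"
proof -
  let ?T = "ext_alg (twisted_sum A V c)"
  interpret T: diff_algebra K lam ?T by fact
  note [simp] = act_rules dopV_rules mult_rules dop_rules
  have cl [simp]: "fst c (x, y) \<in> carrier V" if "x \<in> carrier A" "y \<in> carrier A" for x y
    using f that by auto
  have [simp]: "snd c x \<in> carrier V" if "x \<in> carrier A" for x
    using g that by auto
  have addl: "fst c (x \<oplus>\<^bsub>A\<^esub> x', y) = fst c (x, y) \<oplus>\<^bsub>V\<^esub> fst c (x', y)"
    and addr: "fst c (y, x \<oplus>\<^bsub>A\<^esub> x') = fst c (y, x) \<oplus>\<^bsub>V\<^esub> fst c (y, x')"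
    if "x \<in> carrier A" "x' \<in> carrier A" "y \<in> carrier A" for x x' y
    using T.mult_rules(2)[of "(x, \<zero>\<^bsub>V\<^esub>)" "(x', \<zero>\<^bsub>V\<^esub>)" "(y, \<zero>\<^bsub>V\<^esub>)"]
      T.mult_rules(3)[of "(y, \<zero>\<^bsub>V\<^esub>)" "(x, \<zero>\<^bsub>V\<^esub>)" "(x', \<zero>\<^bsub>V\<^esub>)"] that by auto
  have sml: "fst c (a \<odot>\<^bsub>A\<^esub> x, y) = a \<odot>\<^bsub>V\<^esub> fst c (x, y)"
    and smr: "fst c (x, a \<odot>\<^bsub>A\<^esub> y) = a \<odot>\<^bsub>V\<^esub> fst c (x, y)"
    if "x \<in> carrier A" "y \<in> carrier A" "a \<in> carrier K" for a x y
    using T.mult_rules(4)[of a "(x, \<zero>\<^bsub>V\<^esub>)" "(y, \<zero>\<^bsub>V\<^esub>)"]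
      T.mult_rules(5)[of a "(x, \<zero>\<^bsub>V\<^esub>)" "(y, \<zero>\<^bsub>V\<^esub>)"] that by auto
  have gadd: "snd c (x \<oplus>\<^bsub>A\<^esub> y) = snd c x \<oplus>\<^bsub>V\<^esub> snd c y" if "x \<in> carrier A" "y \<in> carrier A" for x y
    using T.dop_rules(2)[of "(x, \<zero>\<^bsub>V\<^esub>)" "(y, \<zero>\<^bsub>V\<^esub>)"] that by auto
  have gsm: "snd c (a \<odot>\<^bsub>A\<^esub> x) = a \<odot>\<^bsub>V\<^esub> snd c x" if "x \<in> carrier A" "a \<in> carrier K" for a x
    using T.dop_rules(3)[of a "(x, \<zero>\<^bsub>V\<^esub>)"] that by auto
  have hoch: "hoch_d2 A V (fst c) x y z = \<zero>\<^bsub>V\<^esub>"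
    if "x \<in> carrier A" "y \<in> carrier A" "z \<in> carrier A" for x y z
    using T.mult_assoc[of "(x, \<zero>\<^bsub>V\<^esub>)" "(y, \<zero>\<^bsub>V\<^esub>)" "(z, \<zero>\<^bsub>V\<^esub>)"] that f
    by (subst hoch_d2_eq_zero_iff) (auto simp: V.a_comm)
  have dop: "hoch_d1_lam lam A V (snd c) x y \<oplus>\<^bsub>V\<^esub> delta2 lam A V (fst c) x y = \<zero>\<^bsub>V\<^esub>"
    if "x \<in> carrier A" "y \<in> carrier A" for x y
    using T.dop_mult[of "(x, \<zero>\<^bsub>V\<^esub>)" "(y, \<zero>\<^bsub>V\<^esub>)"] that f g
    by (subst cocycle_dop_iff) auto
  show ?thesis
    using f g unfolding cocycles2_iff
    by (auto simp: PiE_def bilinear_map_def linear_maps_def addl addr sml smr gadd gsm hoch dop)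
qed

text \<open>Terms involving the pair cancel by the cocycle conditions, the others by the axioms of
  \<open>A\<close> and of the bimodule. The condition on identity elements needs an argument of its
  own, because such an element may have a nonzero \<open>V\<close>-component.\<close>

lemma twisted_sum_diff_algebra:
  assumes c: "c \<in> cocycles2 K lam A V"
  shows "diff_algebra K lam (ext_alg (twisted_sum A V c))"
proof -
  let ?T = "ext_alg (twisted_sum A V c)"
  have f: "bilinear_map K A A V (\<lambda>x y. fst c (x, y))" and g: "snd c \<in> linear_maps K A V"
    using c by (auto simp: cocycles2_iff)
  note [simp] = act_rules dopV_rules mult_rules dop_rules bilinear_mapD[OF f] linear_mapsD[OF g]
    bilinear_map_zero_left[OF f module_axioms V.module_axioms]
    bilinear_map_zero_right[OF f module_axioms V.module_axioms]
  have hoch: "lact V x (fst c (y, z)) \<oplus>\<^bsub>V\<^esub> fst c (x, y \<otimes>\<^bsub>A\<^esub> z) =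
      fst c (x \<otimes>\<^bsub>A\<^esub> y, z) \<oplus>\<^bsub>V\<^esub> ract V (fst c (x, y)) z"
    if "x \<in> carrier A" "y \<in> carrier A" "z \<in> carrier A" for x y z
    using c that cocycles2_funcset[OF c] by (subst hoch_d2_eq_zero_iff [symmetric]) (auto simp: cocycles2_iff)
  have dop: "dop V (fst c (x, y)) \<oplus>\<^bsub>V\<^esub> snd c (x \<otimes>\<^bsub>A\<^esub> y) =
      ract V (snd c x) y \<oplus>\<^bsub>V\<^esub> fst c (dop A x, y) \<oplus>\<^bsub>V\<^esub> (lact V x (snd c y) \<oplus>\<^bsub>V\<^esub> fst c (x, dop A y)) \<oplus>\<^bsub>V\<^esub>
      lam \<odot>\<^bsub>V\<^esub> (lact V (dop A x) (snd c y) \<oplus>\<^bsub>V\<^esub> ract V (snd c x) (dop A y) \<oplus>\<^bsub>V\<^esub> fst c (dop A x, dop A y))"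
    if "x \<in> carrier A" "y \<in> carrier A" for x y
    using c that cocycles2_funcset[OF c]
    by (intro sym[OF iffD1[OF cocycle_dop_iff]]) (auto simp: cocycles2_iff)
  have ag: "abelian_group ?T"
  proof (rule abelian_groupI)
    fix p assume "p \<in> carrier ?T"
    then show "\<exists>q\<in>carrier ?T. q \<oplus>\<^bsub>?T\<^esub> p = \<zero>\<^bsub>?T\<^esub>"
      by (intro bexI[of _ "(\<ominus>\<^bsub>A\<^esub> fst p, \<ominus>\<^bsub>V\<^esub> snd p)"]) (auto simp: M.l_neg V.l_neg)
  qed (auto simp: M.a_ac V.a_ac)
  have mod: "module K ?T"
    by (rule moduleI)
      (auto intro!: cring_axioms ag simp: smult_l_distr smult_r_distr smult_assoc1
        V.smult_l_distr V.smult_r_distr V.smult_assoc1)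
  interpret T: module K ?T by (rule mod)
  have bil: "bilinear_map K ?T ?T ?T (\<lambda>x y. x \<otimes>\<^bsub>?T\<^esub> y)"
    by (auto simp: bilinear_map_def linear_maps_def V.smult_r_distr V.a_ac)
  have lin: "dop ?T \<in> linear_maps K ?T ?T"
    by (auto simp: linear_maps_def V.smult_r_distr V.a_ac)
  have dopm: "dop ?T (p \<otimes>\<^bsub>?T\<^esub> q) =
      dop ?T p \<otimes>\<^bsub>?T\<^esub> q \<oplus>\<^bsub>?T\<^esub> p \<otimes>\<^bsub>?T\<^esub> dop ?T q \<oplus>\<^bsub>?T\<^esub> lam \<odot>\<^bsub>?T\<^esub> (dop ?T p \<otimes>\<^bsub>?T\<^esub> dop ?T q)"
    if pq: "p \<in> carrier ?T" "q \<in> carrier ?T" for p q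
  proof -
    obtain x u y v where [simp]: "p = (x, u)" "q = (y, v)" by fastforce
    have [simp]: "x \<in> carrier A" "y \<in> carrier A" "u \<in> carrier V" "v \<in> carrier V"
      using pq by auto
    \<comment> \<open>Isolates the two summands that form one side of the cocycle condition, so that
      it can be substituted before the sum is reordered.\<close>
    have "dop V (lact V x v \<oplus>\<^bsub>V\<^esub> ract V u y \<oplus>\<^bsub>V\<^esub> fst c (x, y)) \<oplus>\<^bsub>V\<^esub> snd c (x \<otimes>\<^bsub>A\<^esub> y) =
      dop V (lact V x v) \<oplus>\<^bsub>V\<^esub> dop V (ract V u y) \<oplus>\<^bsub>V\<^esub> (dop V (fst c (x, y)) \<oplus>\<^bsub>V\<^esub> snd c (x \<otimes>\<^bsub>A\<^esub> y))"
      by (simp add: V.a_assoc)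
    note * = this[unfolded dop[OF \<open>x \<in> carrier A\<close> \<open>y \<in> carrier A\<close>]]
    show ?thesis
      unfolding \<open>p = (x, u)\<close> \<open>q = (y, v)\<close> twisted_sum_simps *
      by (simp add: dop_mult dopV_lact dopV_ract V.smult_r_distr V.a_ac)
  qed
  show ?thesis
  proof (intro diff_algebra.intro diff_algebra_axioms.intro)
    show "field K" by (rule field_axioms)
    fix p q r assume "p \<in> carrier ?T" "q \<in> carrier ?T" "r \<in> carrier ?T"
    then show "p \<otimes>\<^bsub>?T\<^esub> q \<otimes>\<^bsub>?T\<^esub> r = p \<otimes>\<^bsub>?T\<^esub> (q \<otimes>\<^bsub>?T\<^esub> r)"
      by (auto simp: mult_assoc lact_mult ract_mult lact_ract hoch V.a_ac)
  next
    fix e assume e: "e \<in> carrier ?T" "\<forall>p\<in>carrier ?T. e \<otimes>\<^bsub>?T\<^esub> p = p \<and> p \<otimes>\<^bsub>?T\<^esub> e = p"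
    obtain a v where av: "e = (a, v)" "a \<in> carrier A" "v \<in> carrier V" using e(1) by auto
    \<comment> \<open>The first component of an identity element is an identity of \<open>A\<close>,
      hence killed by the operator of \<open>A\<close>. So \<open>d(e)\<close> lies in the copy of
      \<open>V\<close>.\<close>
    have "a \<otimes>\<^bsub>A\<^esub> x = x \<and> x \<otimes>\<^bsub>A\<^esub> a = x" if "x \<in> carrier A" for x
      using e(2)[rule_format, of "(x, \<zero>\<^bsub>V\<^esub>)"] that av by auto
    then have a0: "dop A a = \<zero>\<^bsub>A\<^esub>" using dop_unit av by blast
    define w where "w = snd (dop ?T e)"
    have w: "w \<in> carrier V" "dop ?T e = (\<zero>\<^bsub>A\<^esub>, w)" using av a0 by (auto simp: w_def)
    \<comment> \<open>\<open>d(e) = d(e e) = 2 d(e) + lam d(e) d(e)\<close>, and the last term vanishes because \<open>d(e)\<close> lies in \<open>V\<close>\<close>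
    have ww: "dop ?T e \<otimes>\<^bsub>?T\<^esub> dop ?T e = \<zero>\<^bsub>?T\<^esub>" using w by simp
    have mem: "dop ?T e \<in> carrier ?T" using w by simp
    have "dop ?T e = dop ?T (e \<otimes>\<^bsub>?T\<^esub> e)" using bspec[OF e(2) e(1)] by simp
    also have "\<dots> = dop ?T e \<oplus>\<^bsub>?T\<^esub> dop ?T e"
      using dopm[OF e(1) e(1)] e mem ww T.smult_r_null[OF lam_closed] T.M.r_zero T.M.a_closed by metis
    finally have "dop ?T e = \<zero>\<^bsub>?T\<^esub>"
      using mem by (metis T.M.add.r_cancel_one')
    then show "dop ?T e = \<zero>\<^bsub>?T\<^esub>" .
  qed (fact mod bil lin dopm)+
qed

lemma twisted_sum_abelian_extension:
  assumes c: "c \<in> cocycles2 K lam A V"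
  shows "twisted_sum A V c \<in> abelian_extensions K lam A V"
proof -
  have f: "bilinear_map K A A V (\<lambda>x y. fst c (x, y))" and g: "snd c \<in> linear_maps K A V"
    using c by (auto simp: cocycles2_iff)
  note [simp] = act_rules dopV_rules mult_rules dop_rules bilinear_mapD[OF f] linear_mapsD[OF g]
    bilinear_map_zero_left[OF f module_axioms V.module_axioms]
    bilinear_map_zero_right[OF f module_axioms V.module_axioms]
    linear_maps_zero[OF module_axioms V.module_axioms g]
  have "abelian_extension K lam A V (twisted_sum A V c)"
    unfolding abelian_extension_def
  proof (intro conjI)
    show "proj (twisted_sum A V c) ` carrier (ext_alg (twisted_sum A V c)) = carrier A"
      using V.zero_closed by force
  qed (auto simp: twisted_sum_diff_algebra[OF c] diff_hom_def linear_maps_def inj_on_def)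
  moreover have "induces_bimodule K A V (twisted_sum A V c)"
    unfolding induces_bimodule_def
  proof (intro ballI)
    fix s x v assume s: "s \<in> sections K A (twisted_sum A V c)" and xv: "x \<in> carrier A" "v \<in> carrier V"
    \<comment> \<open>The component \<open>u\<close> depends on the section, but in products with
      \<open>(0, v)\<close> it is only acted on by the zero of \<open>A\<close>, and the twist
      vanishes there by bilinearity.\<close>
    then obtain u where "s x = (x, u)" "u \<in> carrier V"
      using linear_maps_closed[of s K A "ext_alg (twisted_sum A V c)" x]
      by (cases "s x") (auto simp: sections_def)
    then show "incl (twisted_sum A V c) (lact V x v) = s x \<otimes>\<^bsub>ext_alg (twisted_sum A V c)\<^esub> incl (twisted_sum A V c) v \<and>
       incl (twisted_sum A V c) (ract V v x) = incl (twisted_sum A V c) v \<otimes>\<^bsub>ext_alg (twisted_sum A V c)\<^esub> s x"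
      using xv by simp
  qed
  ultimately show ?thesis by (simp add: abelian_extensions_def)
qed

text \<open>Transport makes the twisted sum a differential algebra, and its axioms contain the
  cocycle conditions. This replaces direct verification, both for pairs coming from sections and for
  cocycles shifted by coboundaries.\<close>

lemma isomorphic_twisted_sums_cocycle:
  assumes f: "fst c \<in> (carrier A \<times> carrier A) \<rightarrow>\<^sub>E carrier V" and g: "snd c \<in> carrier A \<rightarrow>\<^sub>E carrier V"
    and E: "E \<in> abelian_extensions K lam A V" and iso: "isomorphic_extensions K V (twisted_sum A V c) E"
  shows "c \<in> cocycles2 K lam A V"
proof -
  have "closed_structure K (ext_alg (twisted_sum A V c))"
    using f g by (auto simp: closed_structure_def act_rules dopV_rules mult_rules dop_rules)
  then have "twisted_sum A V c \<in> abelian_extensions K lam A V"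
    by (rule abelian_extensions_transfer[OF diff_bimodule_axioms lam_closed E]) (use iso in auto)
  then show ?thesis
    using f g by (intro twisted_sum_cocycle ext_diff_algebra) (auto simp: abelian_extensions_def)
qed

section \<open>The pair of maps given by a section\<close>

lemma section_cocycle_props:
  assumes E: "E \<in> abelian_extensions K lam A V" and s: "s \<in> sections K A E"
  shows "fst (section_cocycle A V E s) \<in> (carrier A \<times> carrier A) \<rightarrow>\<^sub>E carrier V"
    and "snd (section_cocycle A V E s) \<in> carrier A \<rightarrow>\<^sub>E carrier V"
    and "\<And>x y. \<lbrakk>x \<in> carrier A; y \<in> carrier A\<rbrakk> \<Longrightarrow> incl E (fst (section_cocycle A V E s) (x, y)) =
      s x \<otimes>\<^bsub>ext_alg E\<^esub> s y \<ominus>\<^bsub>ext_alg E\<^esub> s (x \<otimes>\<^bsub>A\<^esub> y)"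
    and "\<And>x. x \<in> carrier A \<Longrightarrow> incl E (snd (section_cocycle A V E s) x) =
      dop (ext_alg E) (s x) \<ominus>\<^bsub>ext_alg E\<^esub> s (dop A x)"
proof -
  have ab: "abelian_extension K lam A V E"
    using E by (simp add: abelian_extensions_def)
  interpret B: diff_algebra K lam "ext_alg E" using ab by (rule ext_diff_algebra)
  have sl: "s \<in> linear_maps K A (ext_alg E)" and sp: "\<And>x. x \<in> carrier A \<Longrightarrow> proj E (s x) = x"
    using s by (auto simp: sections_def)
  note [simp] = mult_rules dop_rules B.mult_rules B.dop_rules linear_mapsD[OF sl] sp
    linear_maps_minus[OF B.module_axioms module_axioms diff_hom_linear[OF proj_hom[OF ab]]]
    diff_hom_mult[OF proj_hom[OF ab]] diff_hom_dop[OF proj_hom[OF ab]] M.r_neg M.minus_eq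
  \<comment> \<open>Both differences are killed by the projection, as it is a homomorphism with the
    section as right inverse. By exactness they lie in the image of \<open>V\<close>, where
    \<open>inv_into\<close> is a true inverse of the inclusion.\<close>
  have ker: "e \<in> incl E ` carrier V" if "e \<in> carrier (ext_alg E)" "proj E e = \<zero>\<^bsub>A\<^esub>" for e
    using that incl_image[OF ab] by blast
  have 1: "s x \<otimes>\<^bsub>ext_alg E\<^esub> s y \<ominus>\<^bsub>ext_alg E\<^esub> s (x \<otimes>\<^bsub>A\<^esub> y) \<in> incl E ` carrier V"
    if "x \<in> carrier A" "y \<in> carrier A" for x y using that by (intro ker) auto
  have 2: "dop (ext_alg E) (s x) \<ominus>\<^bsub>ext_alg E\<^esub> s (dop A x) \<in> incl E ` carrier V"
    if "x \<in> carrier A" for x using that by (intro ker) auto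
  show "fst (section_cocycle A V E s) \<in> (carrier A \<times> carrier A) \<rightarrow>\<^sub>E carrier V"
    "snd (section_cocycle A V E s) \<in> carrier A \<rightarrow>\<^sub>E carrier V"
    by (auto simp: section_cocycle_def inv_into_into[OF 1] inv_into_into[OF 2] simp del: B.M.minus_eq M.minus_eq)
  show "\<And>x y. \<lbrakk>x \<in> carrier A; y \<in> carrier A\<rbrakk> \<Longrightarrow> incl E (fst (section_cocycle A V E s) (x, y)) =
      s x \<otimes>\<^bsub>ext_alg E\<^esub> s y \<ominus>\<^bsub>ext_alg E\<^esub> s (x \<otimes>\<^bsub>A\<^esub> y)"
    "\<And>x. x \<in> carrier A \<Longrightarrow> incl E (snd (section_cocycle A V E s) x) =
      dop (ext_alg E) (s x) \<ominus>\<^bsub>ext_alg E\<^esub> s (dop A x)"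
    by (simp_all add: section_cocycle_def f_inv_into_f[OF 1] f_inv_into_f[OF 2] del: M.minus_eq)
qed

text \<open>The failure of \<open>s\<close> to respect products and operators is exactly the pair by
  which the sum is twisted, so the comparison map \<open>h\<close> respects both. Exactness makes
  \<open>h\<close> bijective.\<close>

lemma twisted_sum_section_cocycle:
  assumes E: "E \<in> abelian_extensions K lam A V" and s: "s \<in> sections K A E"
  shows "isomorphic_extensions K V (twisted_sum A V (section_cocycle A V E s)) E"
proof -
  let ?c = "section_cocycle A V E s" and ?B = "ext_alg E"
  define h where "h = (\<lambda>(x, v). s x \<oplus>\<^bsub>?B\<^esub> incl E v)"
  have h_simp [simp]: "h (x, v) = s x \<oplus>\<^bsub>?B\<^esub> incl E v" for x v by (simp add: h_def)
  have ab: "abelian_extension K lam A V E" and ind: "induces_bimodule K A V E"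
    using E by (auto simp: abelian_extensions_def)
  interpret B: diff_algebra K lam ?B using ab by (rule ext_diff_algebra)
  have sl: "s \<in> linear_maps K A ?B" and sp: "\<And>x. x \<in> carrier A \<Longrightarrow> proj E (s x) = x"
    using s by (auto simp: sections_def)
  have si: "s x \<otimes>\<^bsub>?B\<^esub> incl E v = incl E (lact V x v)" "incl E v \<otimes>\<^bsub>?B\<^esub> s x = incl E (ract V v x)"
    if "x \<in> carrier A" "v \<in> carrier V" for x v
    using ind s that by (auto simp: induces_bimodule_def)
  note sc = section_cocycle_props[OF E s]
  have cl [simp]: "fst ?c (x, y) \<in> carrier V" "snd ?c x \<in> carrier V" if "x \<in> carrier A" "y \<in> carrier A" for x y
    using sc(1,2) that by auto
  note il = incl_linear[OF ab]
  note pl = diff_hom_linear[OF proj_hom[OF ab]]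
  have incl_zero: "incl E \<zero>\<^bsub>V\<^esub> = \<zero>\<^bsub>?B\<^esub>"
    by (rule linear_maps_zero[OF V.module_axioms B.module_axioms il])
  have incl_proj: "proj E (incl E v) = \<zero>\<^bsub>A\<^esub>" if "v \<in> carrier V" for v
    using incl_image[OF ab] that by auto
  note [simp] = mult_rules dop_rules act_rules dopV_rules B.mult_rules B.dop_rules linear_mapsD[OF sl] linear_mapsD[OF il]
    linear_mapsD[OF pl] sp incl_mult[OF ab] incl_dop[OF ab] si incl_zero incl_proj
  have mult_s: "s x \<otimes>\<^bsub>?B\<^esub> s y = s (x \<otimes>\<^bsub>A\<^esub> y) \<oplus>\<^bsub>?B\<^esub> incl E (fst ?c (x, y))"
    if "x \<in> carrier A" "y \<in> carrier A" for x y
    using that by (simp add: sc(3) B.M.add_minus_cancel)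
  have dop_s: "dop ?B (s x) = s (dop A x) \<oplus>\<^bsub>?B\<^esub> incl E (snd ?c x)" if "x \<in> carrier A" for x
    using that by (simp add: sc(4) B.M.add_minus_cancel)
  have "h \<in> diff_hom K (ext_alg (twisted_sum A V ?c)) ?B"
    by (auto simp: diff_hom_def linear_maps_def B.smult_r_distr mult_s dop_s B.M.a_ac)
  moreover have "bij_betw h (carrier (ext_alg (twisted_sum A V ?c))) (carrier ?B)"
    unfolding bij_betw_def
  proof
    show "inj_on h (carrier (ext_alg (twisted_sum A V ?c)))"
    proof (rule inj_onI, clarsimp)
      fix x u y v assume xy: "x \<in> carrier A" "u \<in> carrier V" "y \<in> carrier A" "v \<in> carrier V"
        and eq: "s x \<oplus>\<^bsub>?B\<^esub> incl E u = s y \<oplus>\<^bsub>?B\<^esub> incl E v"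
      have "proj E (s x \<oplus>\<^bsub>?B\<^esub> incl E u) = x" "proj E (s y \<oplus>\<^bsub>?B\<^esub> incl E v) = y"
        using xy by simp_all
      then have "x = y" using eq by simp
      moreover from this have "u = v"
        using eq xy inj_onD[OF incl_inj[OF ab]] by simp
      ultimately show "x = y \<and> u = v" by simp
    qed
    show "h ` carrier (ext_alg (twisted_sum A V ?c)) = carrier ?B"
    proof (intro equalityI subsetI)
      fix e assume e: "e \<in> carrier ?B"
      \<comment> \<open>Subtracting the section value over its projection moves \<open>e\<close>
        into the kernel, which supplies the \<open>V\<close>-component of its preimage.\<close>
      have "e \<ominus>\<^bsub>?B\<^esub> s (proj E e) \<in> incl E ` carrier V"
        unfolding incl_image[OF ab] using e
        by (simp add: linear_maps_minus[OF B.module_axioms module_axioms pl] M.minus_eq M.r_neg)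
      then obtain v where v: "v \<in> carrier V" "e \<ominus>\<^bsub>?B\<^esub> s (proj E e) = incl E v" by blast
      have "h (proj E e, v) = e"
        using e by (simp add: v(2)[symmetric] B.M.add_minus_cancel)
      then show "e \<in> h ` carrier (ext_alg (twisted_sum A V ?c))"
        using e v(1) by (auto intro!: rev_image_eqI[of "(proj E e, v)"])
    qed auto
  qed
  ultimately show ?thesis
    by (rule isomorphic_extensionsI) (auto simp: linear_maps_zero[OF module_axioms B.module_axioms sl])
qed

lemma section_cocycle_mem:
  assumes "E \<in> abelian_extensions K lam A V" "s \<in> sections K A E"
  shows "section_cocycle A V E s \<in> cocycles2 K lam A V"
  using isomorphic_twisted_sums_cocycle[OF section_cocycle_props(1,2)[OF assms] assms(1)
      twisted_sum_section_cocycle[OF assms]] .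

section \<open>Coboundaries and isomorphisms of twisted sums\<close>

lemma mult_cocycle_group:
  "c \<otimes>\<^bsub>cocycle_group K lam A V\<^esub> c' =
    ((\<lambda>p\<in>carrier A \<times> carrier A. fst c p \<oplus>\<^bsub>V\<^esub> fst c' p), (\<lambda>x\<in>carrier A. snd c x \<oplus>\<^bsub>V\<^esub> snd c' x))"
  by (simp add: cocycle_group_def case_prod_beta)

lemma carrier_cocycle_group [simp]: "carrier (cocycle_group K lam A V) = cocycles2 K lam A V"
  by (simp add: cocycle_group_def)

text \<open>Adding \<open>\<phi>\<close> in the \<open>V\<close>-component maps the sum twisted by
  \<open>c'\<close> to the one twisted by \<open>c\<close>. This isomorphism also yields that
  \<open>c'\<close> is a cocycle.\<close>

lemma cobdry_shift:
  assumes c: "c \<in> cocycles2 K lam A V" and phi: "\<phi> \<in> Hom1 K A V"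
  defines "c' \<equiv> cobdry A V \<phi> \<otimes>\<^bsub>cocycle_group K lam A V\<^esub> c"
  shows "c' \<in> cocycles2 K lam A V"
    and "isomorphic_extensions K V (twisted_sum A V c') (twisted_sum A V c)"
proof -
  have pl: "\<phi> \<in> linear_maps K A V" using phi by (simp add: Hom1_def)
  have cl [simp]: "fst c (x, y) \<in> carrier V" "snd c x \<in> carrier V" if "x \<in> carrier A" "y \<in> carrier A" for x y
    using cocycles2_funcset[OF c] that by auto
  note [simp] = mult_rules dop_rules act_rules dopV_rules linear_mapsD[OF pl] linear_maps_zero[OF module_axioms V.module_axioms pl]
  have f: "fst c' (x, y) = hoch_d1 A V \<phi> x y \<oplus>\<^bsub>V\<^esub> fst c (x, y)" if "x \<in> carrier A" "y \<in> carrier A" for x y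
    using that by (simp add: c'_def mult_cocycle_group cobdry_def)
  have g: "snd c' x = \<ominus>\<^bsub>V\<^esub> delta1 A V \<phi> x \<oplus>\<^bsub>V\<^esub> snd c x" if "x \<in> carrier A" for x
    using that by (simp add: c'_def mult_cocycle_group cobdry_def)
  have [simp]: "hoch_d1 A V \<phi> x y \<in> carrier V" "delta1 A V \<phi> x \<in> carrier V"
    if "x \<in> carrier A" "y \<in> carrier A" for x y
    using that by (simp_all add: hoch_d1_def delta1_def)
  \<comment> \<open>With the subtracted terms moved to the left, \<open>f'\<close> and
    \<open>g'\<close> say that the map \<open>h\<close> defined below respects products and
    operators on elements \<open>(x, 0)\<close>.\<close>
  have f': "fst c' (x, y) \<oplus>\<^bsub>V\<^esub> \<phi> (x \<otimes>\<^bsub>A\<^esub> y) = lact V x (\<phi> y) \<oplus>\<^bsub>V\<^esub> ract V (\<phi> x) y \<oplus>\<^bsub>V\<^esub> fst c (x, y)"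
    if "x \<in> carrier A" "y \<in> carrier A" for x y
  proof -
    have "\<lbrakk>p \<in> carrier V; q \<in> carrier V; r \<in> carrier V; t \<in> carrier V\<rbrakk> \<Longrightarrow>
      p \<ominus>\<^bsub>V\<^esub> q \<oplus>\<^bsub>V\<^esub> r \<oplus>\<^bsub>V\<^esub> t \<oplus>\<^bsub>V\<^esub> q = p \<oplus>\<^bsub>V\<^esub> r \<oplus>\<^bsub>V\<^esub> t" for p q r t
      by algebra
    then show ?thesis using that by (simp add: f hoch_d1_def)
  qed
  have g': "snd c' x \<oplus>\<^bsub>V\<^esub> \<phi> (dop A x) = dop V (\<phi> x) \<oplus>\<^bsub>V\<^esub> snd c x"
    if "x \<in> carrier A" for x
  proof -
    have "\<lbrakk>p \<in> carrier V; q \<in> carrier V; r \<in> carrier V\<rbrakk> \<Longrightarrow>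
      \<ominus>\<^bsub>V\<^esub> (p \<ominus>\<^bsub>V\<^esub> q) \<oplus>\<^bsub>V\<^esub> r \<oplus>\<^bsub>V\<^esub> p = q \<oplus>\<^bsub>V\<^esub> r" for p q r
      by algebra
    then show ?thesis using that by (simp add: g delta1_def)
  qed
  have fc: "fst c' \<in> (carrier A \<times> carrier A) \<rightarrow>\<^sub>E carrier V" "snd c' \<in> carrier A \<rightarrow>\<^sub>E carrier V"
    by (auto simp: f g) (auto simp: c'_def mult_cocycle_group split: if_splits)
  have [simp]: "fst c' (x, y) \<in> carrier V" "snd c' x \<in> carrier V" if "x \<in> carrier A" "y \<in> carrier A" for x y
    using fc that by auto
  define h where "h = (\<lambda>(x, v). (x, v \<oplus>\<^bsub>V\<^esub> \<phi> x))"
  have [simp]: "h (x, v) = (x, v \<oplus>\<^bsub>V\<^esub> \<phi> x)" for x v by (simp add: h_def)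
  have "h \<in> diff_hom K (ext_alg (twisted_sum A V c')) (ext_alg (twisted_sum A V c))"
    by (auto simp: diff_hom_def linear_maps_def V.smult_r_distr V.a_assoc f' g') (auto simp: V.a_ac)
  moreover have "bij_betw h (carrier (ext_alg (twisted_sum A V c'))) (carrier (ext_alg (twisted_sum A V c)))"
    by (rule bij_betw_byWitness[where f' = "\<lambda>(x, v). (x, v \<ominus>\<^bsub>V\<^esub> \<phi> x)"])
      (auto simp: V.minus_eq V.a_assoc V.r_neg V.l_neg)
  ultimately show iso: "isomorphic_extensions K V (twisted_sum A V c') (twisted_sum A V c)"
    by (rule isomorphic_extensionsI) auto
  show "c' \<in> cocycles2 K lam A V"
    by (rule isomorphic_twisted_sums_cocycle[OF fc twisted_sum_abelian_extension[OF c] iso])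
qed

text \<open>An isomorphism that fixes \<open>V\<close> and lies over \<open>A\<close> is determined
  by the \<open>V\<close>-components of its values on the elements \<open>(x, 0)\<close>; these form
  \<open>\<phi>\<close>. Its compatibility with products and operators then expresses
  \<open>c'\<close> through \<open>c\<close> and the coboundary of \<open>\<phi>\<close>.\<close>

lemma isomorphic_twisted_sums_cobdry:
  assumes c: "c \<in> cocycles2 K lam A V" and c': "c' \<in> cocycles2 K lam A V"
    and iso: "isomorphic_extensions K V (twisted_sum A V c') (twisted_sum A V c)"
  shows "\<exists>\<phi>\<in>Hom1 K A V. c' = cobdry A V \<phi> \<otimes>\<^bsub>cocycle_group K lam A V\<^esub> c"
proof -
  let ?T' = "ext_alg (twisted_sum A V c')" and ?T = "ext_alg (twisted_sum A V c)"
  obtain h where h: "h \<in> diff_hom K ?T' ?T"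
    and hi: "\<And>v. v \<in> carrier V \<Longrightarrow> h (\<zero>\<^bsub>A\<^esub>, v) = (\<zero>\<^bsub>A\<^esub>, v)"
    and hp: "\<And>x v. \<lbrakk>x \<in> carrier A; v \<in> carrier V\<rbrakk> \<Longrightarrow> fst (h (x, v)) = x"
    using iso by (auto simp: isomorphic_extensions_def)
  note hl = linear_mapsD[OF diff_hom_linear[OF h]] diff_hom_mult[OF h] diff_hom_dop[OF h]
  define \<phi> where "\<phi> = (\<lambda>x\<in>carrier A. snd (h (x, \<zero>\<^bsub>V\<^esub>)))"
  have phi [simp]: "\<phi> x \<in> carrier V" if "x \<in> carrier A" for x
    using hl(1)[of "(x, \<zero>\<^bsub>V\<^esub>)"] that by (auto simp: \<phi>_def mem_Times_iff)
  note [simp] = mult_rules dop_rules act_rules dopV_rules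
  have h0: "h (x, \<zero>\<^bsub>V\<^esub>) = (x, \<phi> x)" if "x \<in> carrier A" for x
    using that hp[of x "\<zero>\<^bsub>V\<^esub>"] by (simp add: \<phi>_def prod_eq_iff)
  \<comment> \<open>Decomposes \<open>(x, v)\<close> as the sum of \<open>(x, 0)\<close> and
    \<open>(0, v)\<close>, the latter being fixed.\<close>
  have h1: "h (x, v) = (x, \<phi> x \<oplus>\<^bsub>V\<^esub> v)" if "x \<in> carrier A" "v \<in> carrier V" for x v
    using hl(2)[of "(x, \<zero>\<^bsub>V\<^esub>)" "(\<zero>\<^bsub>A\<^esub>, v)"] that by (simp add: h0 hi)
  have [simp]: "fst c (x, y) \<in> carrier V" "snd c x \<in> carrier V"
    "fst c' (x, y) \<in> carrier V" "snd c' x \<in> carrier V" if "x \<in> carrier A" "y \<in> carrier A" for x y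
    using cocycles2_funcset[OF c] cocycles2_funcset[OF c'] that by auto
  have "\<phi> \<in> Hom1 K A V"
  proof -
    have "\<phi> (x \<oplus>\<^bsub>A\<^esub> y) = \<phi> x \<oplus>\<^bsub>V\<^esub> \<phi> y" if "x \<in> carrier A" "y \<in> carrier A" for x y
      using hl(2)[of "(x, \<zero>\<^bsub>V\<^esub>)" "(y, \<zero>\<^bsub>V\<^esub>)"] that by (simp add: h0)
    moreover have "\<phi> (a \<odot>\<^bsub>A\<^esub> x) = a \<odot>\<^bsub>V\<^esub> \<phi> x" if "x \<in> carrier A" "a \<in> carrier K" for a x
      using hl(3)[of a "(x, \<zero>\<^bsub>V\<^esub>)"] that by (simp add: h0)
    moreover have "\<phi> \<in> extensional (carrier A)" by (simp add: \<phi>_def)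
    ultimately show ?thesis by (auto simp: Hom1_def linear_maps_def)
  qed
  moreover have "c' = cobdry A V \<phi> \<otimes>\<^bsub>cocycle_group K lam A V\<^esub> c"
  proof -
    have "fst c' (x, y) = hoch_d1 A V \<phi> x y \<oplus>\<^bsub>V\<^esub> fst c (x, y)" if "x \<in> carrier A" "y \<in> carrier A" for x y
    proof -
      have e: "\<phi> (x \<otimes>\<^bsub>A\<^esub> y) \<oplus>\<^bsub>V\<^esub> fst c' (x, y) = lact V x (\<phi> y) \<oplus>\<^bsub>V\<^esub> ract V (\<phi> x) y \<oplus>\<^bsub>V\<^esub> fst c (x, y)"
        using hl(4)[of "(x, \<zero>\<^bsub>V\<^esub>)" "(y, \<zero>\<^bsub>V\<^esub>)"] that by (simp add: h0 h1)
      have "fst c' (x, y) = \<ominus>\<^bsub>V\<^esub> \<phi> (x \<otimes>\<^bsub>A\<^esub> y) \<oplus>\<^bsub>V\<^esub> (\<phi> (x \<otimes>\<^bsub>A\<^esub> y) \<oplus>\<^bsub>V\<^esub> fst c' (x, y))"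
        using that by (simp add: V.r_neg1)
      also have "\<dots> = hoch_d1 A V \<phi> x y \<oplus>\<^bsub>V\<^esub> fst c (x, y)"
        unfolding e using that by (simp add: hoch_d1_def V.minus_eq V.a_ac)
      finally show ?thesis .
    qed
    moreover have "snd c' x = \<ominus>\<^bsub>V\<^esub> delta1 A V \<phi> x \<oplus>\<^bsub>V\<^esub> snd c x" if "x \<in> carrier A" for x
    proof -
      have e: "\<phi> (dop A x) \<oplus>\<^bsub>V\<^esub> snd c' x = dop V (\<phi> x) \<oplus>\<^bsub>V\<^esub> snd c x"
        using hl(5)[of "(x, \<zero>\<^bsub>V\<^esub>)"] that by (simp add: h0 h1)
      have "snd c' x = \<ominus>\<^bsub>V\<^esub> \<phi> (dop A x) \<oplus>\<^bsub>V\<^esub> (\<phi> (dop A x) \<oplus>\<^bsub>V\<^esub> snd c' x)"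
        using that by (simp add: V.r_neg1)
      also have "\<dots> = \<ominus>\<^bsub>V\<^esub> delta1 A V \<phi> x \<oplus>\<^bsub>V\<^esub> snd c x"
        unfolding e using that by (simp add: delta1_def V.minus_eq V.minus_add V.a_ac)
      finally show ?thesis .
    qed
    ultimately show ?thesis
      using cocycles2_funcset[OF c']
      by (auto simp: mult_cocycle_group cobdry_def prod_eq_iff PiE_def intro!: extensionalityI)
  qed
  ultimately show ?thesis by blast
qed

text \<open>Turns cosets into isomorphism classes, so that the final argument compares cohomology
  classes only by composing and inverting isomorphisms.\<close>

lemma cohomology_class_eq:
  assumes c: "c \<in> cocycles2 K lam A V"
  shows "cohomology_class K lam A V c =
    {c' \<in> cocycles2 K lam A V. isomorphic_extensions K V (twisted_sum A V c') (twisted_sum A V c)}"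
  using cobdry_shift[OF c] isomorphic_twisted_sums_cobdry[OF c]
  by (auto simp: cohomology_class_def r_coset_def coboundaries2_def)

lemma carrier_cohomology2:
  "carrier (cohomology2 K lam A V) = cohomology_class K lam A V ` cocycles2 K lam A V"
  by (simp add: cohomology2_def carrier_FactGroup cohomology_class_def)

text \<open>A twisted sum lives on pairs, while the classified extensions have their elements in the
  type \<open>'e\<close>. Each operation is carried along \<open>j\<close>: decode the arguments by
  \<open>k\<close>, compute in \<open>E\<close>, and encode the result.\<close>

lemma abelian_extension_copy:
  fixes j :: "'f \<Rightarrow> 'e" and E :: "('k, 'a, 'v, 'f) extension"
  assumes E: "E \<in> abelian_extensions K lam A V" and j: "inj_on j (carrier (ext_alg E))"
  shows "\<exists>E' :: ('k, 'a, 'v, 'e) extension.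
    E' \<in> abelian_extensions K lam A V \<and> isomorphic_extensions K V E' E"
proof -
  let ?B = "ext_alg E"
  have ab: "abelian_extension K lam A V E" using E by (simp add: abelian_extensions_def)
  interpret B: diff_algebra K lam ?B using ab by (rule ext_diff_algebra)
  note [simp] = B.mult_rules B.dop_rules linear_mapsD[OF incl_linear[OF ab]]
    linear_maps_zero[OF V.module_axioms B.module_axioms incl_linear[OF ab]]
  define k where "k = inv_into (carrier ?B) j"
  have [simp]: "k (j e) = e" if "e \<in> carrier ?B" for e
    using j that by (simp add: k_def)
  define E' where "E' = \<lparr>ext_alg = \<lparr>carrier = j ` carrier ?B,
      mult = (\<lambda>x y. j (k x \<otimes>\<^bsub>?B\<^esub> k y)), one = undefined, zero = j \<zero>\<^bsub>?B\<^esub>,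
      add = (\<lambda>x y. j (k x \<oplus>\<^bsub>?B\<^esub> k y)), smult = (\<lambda>a x. j (a \<odot>\<^bsub>?B\<^esub> k x)), dop = (\<lambda>x. j (dop ?B (k x)))\<rparr>,
    incl = (\<lambda>v. j (incl E v)), proj = (\<lambda>x. proj E (k x))\<rparr>"
  have iso: "isomorphic_extensions K V E' E"
  proof (rule isomorphic_extensionsI)
    show "k \<in> diff_hom K (ext_alg E') ?B"
      by (auto simp: E'_def diff_hom_def linear_maps_def)
    show "bij_betw k (carrier (ext_alg E')) (carrier ?B)"
      by (rule bij_betw_byWitness[where f' = j]) (auto simp: E'_def)
  qed (auto simp: E'_def)
  have "E' \<in> abelian_extensions K lam A V"
  proof (rule abelian_extensions_transfer[OF diff_bimodule_axioms lam_closed E _ _ _ iso])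
    show "closed_structure K (ext_alg E')"
      by (auto simp: E'_def closed_structure_def)
  qed (auto simp: E'_def)
  then show ?thesis using iso by blast
qed

end

section \<open>The classification of abelian extensions\<close>

theorem theorem4p5:
  fixes K :: "('k, 'm) ring_scheme" and lam :: 'k
    and A :: "('k, 'a) diff_module"
    and V :: "('k, 'v, 'a) diff_bimod"
    and j :: "'a \<times> 'v \<Rightarrow> 'e"
  assumes "field K"
    and "\<forall>n::nat. n > 0 \<longrightarrow> [n] \<cdot>\<^bsub>K\<^esub> \<one>\<^bsub>K\<^esub> \<noteq> \<zero>\<^bsub>K\<^esub>"
    and "lam \<in> carrier K"
    and "diff_algebra K lam A"
    and "diff_bimodule K lam A V"
    \<comment> \<open>the universe of the extensions is large enough to contain a copy of \<open>A \<times> V\<close>\<close>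
    and "inj_on j (carrier A \<times> carrier V)"
  shows "equiv (abelian_extensions K lam A V :: ('k, 'a, 'v, 'e) extension set)
           (extension_iso_rel K lam A V) \<and>
         (\<forall>E\<in>(abelian_extensions K lam A V :: ('k, 'a, 'v, 'e) extension set).
           sections K A E \<noteq> {}) \<and>
         (\<exists>\<Phi>. bij_betw \<Phi>
             ((abelian_extensions K lam A V :: ('k, 'a, 'v, 'e) extension set) //
               extension_iso_rel K lam A V)
             (carrier (cohomology2 K lam A V)) \<and>
           (\<forall>E\<in>abelian_extensions K lam A V. \<forall>s\<in>sections K A E.
             \<Phi> (extension_iso_rel K lam A V `` {E}) =
               cohomology_class K lam A V (section_cocycle A V E s)))"
proof -
  interpret diff_bimodule K lam A V by fact
  interpret weighted_bimodule K lam A V by unfold_locales fact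
  let ?X = "abelian_extensions K lam A V :: ('k, 'a, 'v, 'e) extension set"
  let ?R = "extension_iso_rel K lam A V :: (('k, 'a, 'v, 'e) extension \<times> _) set"
  let ?T = "twisted_sum A V"
  let ?Z = "cocycles2 K lam A V"
  have R_iff: "(E, E') \<in> ?R \<longleftrightarrow> E \<in> ?X \<and> E' \<in> ?X \<and> isomorphic_extensions K V E E'" for E E'
    by (simp add: extension_iso_rel_def)
  have equiv: "equiv ?X ?R"
  proof (rule equivI)
    show "?R \<subseteq> ?X \<times> ?X" by (auto simp: R_iff)
    show "refl_on ?X ?R" by (simp add: refl_on_def R_iff isomorphic_extensions_refl)
    show "sym ?R" unfolding sym_def R_iff by (blast intro: abelian_extensions_sym)
    show "trans ?R" unfolding trans_def R_iff by (blast intro: isomorphic_extensions_trans)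
  qed
  have sec: "sections K A E \<noteq> {}" if "E \<in> ?X" for E
    using that by (intro sections_nonempty[OF diff_algebra_axioms]) (auto simp: abelian_extensions_def)
  \<comment> \<open>Quantifying over the members of \<open>Y\<close> avoids a choice of
    representative or section. The fact \<open>Phi\<close> then shows that any one representative
    yields the whole set.\<close>
  define \<Phi> where "\<Phi> = (\<lambda>Y :: ('k, 'a, 'v, 'e) extension set. {c \<in> ?Z. \<exists>E\<in>Y. isomorphic_extensions K V (?T c) E})"
  have Phi: "\<Phi> (?R `` {E}) = {c \<in> ?Z. isomorphic_extensions K V (?T c) E}" if "E \<in> ?X" for E
  proof -
    have "(\<exists>E'\<in>?R `` {E}. isomorphic_extensions K V (?T c) E') \<longleftrightarrow> isomorphic_extensions K V (?T c) E" for c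
    proof
      assume "\<exists>E'\<in>?R `` {E}. isomorphic_extensions K V (?T c) E'"
      then obtain E' where E': "E' \<in> ?X" "isomorphic_extensions K V E E'" "isomorphic_extensions K V (?T c) E'"
        by (auto simp: R_iff)
      show "isomorphic_extensions K V (?T c) E"
        by (rule isomorphic_extensions_trans[OF E'(3) abelian_extensions_sym[OF that E'(2)]])
    next
      assume "isomorphic_extensions K V (?T c) E"
      then show "\<exists>E'\<in>?R `` {E}. isomorphic_extensions K V (?T c) E'"
        using equiv_class_self[OF equiv that] by blast
    qed
    then show ?thesis by (simp add: \<Phi>_def)
  qed
  have Phi_class: "\<Phi> (?R `` {E}) = cohomology_class K lam A V c"
    if "E \<in> ?X" "c \<in> ?Z" "isomorphic_extensions K V (?T c) E" for E c
  proof -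
    have E: "isomorphic_extensions K V E (?T c)"
      by (rule abelian_extensions_sym[OF twisted_sum_abelian_extension[OF that(2)] that(3)])
    then have "isomorphic_extensions K V (?T c') E \<longleftrightarrow> isomorphic_extensions K V (?T c') (?T c)" for c'
      using isomorphic_extensions_trans[OF _ that(3)] isomorphic_extensions_trans[OF _ E] by blast
    then show ?thesis
      by (simp add: Phi[OF that(1)] cohomology_class_eq[OF that(2)])
  qed
  \<comment> \<open>The left side does not mention \<open>s\<close>, so this also shows that the
    class of the pair is independent of the section.\<close>
  have val: "\<Phi> (?R `` {E}) = cohomology_class K lam A V (section_cocycle A V E s)"
    if "E \<in> ?X" "s \<in> sections K A E" for E s
    using that by (intro Phi_class section_cocycle_mem twisted_sum_section_cocycle)
  have inj: "?R `` {E} = ?R `` {E'}" if E: "E \<in> ?X" "E' \<in> ?X" and eq: "\<Phi> (?R `` {E}) = \<Phi> (?R `` {E'})" for E E'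
  proof -
    \<comment> \<open>The cocycle of a section of \<open>E\<close> belongs to the value at the class
      of \<open>E\<close>, hence to the equal value at the class of \<open>E'\<close>. Both
      extensions are therefore isomorphic to one twisted sum.\<close>
    obtain s where s: "s \<in> sections K A E" using sec[OF E(1)] by blast
    let ?c = "section_cocycle A V E s"
    have c: "?c \<in> ?Z" "isomorphic_extensions K V (?T ?c) E"
      using E s by (auto intro: section_cocycle_mem twisted_sum_section_cocycle)
    then have "isomorphic_extensions K V (?T ?c) E'"
      using eq unfolding Phi[OF E(1)] Phi[OF E(2)] by blast
    then have "isomorphic_extensions K V E E'"
      by (rule isomorphic_extensions_trans[OF abelian_extensions_sym[OF twisted_sum_abelian_extension[OF c(1)] c(2)]])
    then have "(E, E') \<in> ?R" using E by (simp add: extension_iso_rel_def)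
    then show ?thesis by (rule equiv_class_eq[OF equiv])
  qed
  have "bij_betw \<Phi> (?X // ?R) (carrier (cohomology2 K lam A V))"
    unfolding bij_betw_def
  proof
    show "inj_on \<Phi> (?X // ?R)"
    proof (rule inj_onI)
      fix Y Y' assume "Y \<in> ?X // ?R" "Y' \<in> ?X // ?R" "\<Phi> Y = \<Phi> Y'"
      then show "Y = Y'" using inj by (elim quotientE) simp
    qed
    show "\<Phi> ` (?X // ?R) = carrier (cohomology2 K lam A V)"
    proof (intro equalityI subsetI)
      fix y assume "y \<in> \<Phi> ` (?X // ?R)"
      then obtain E where E: "E \<in> ?X" "y = \<Phi> (?R `` {E})" by (auto elim!: quotientE)
      then show "y \<in> carrier (cohomology2 K lam A V)"
        using sec[OF E(1)] val section_cocycle_mem unfolding carrier_cohomology2 by blast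
    next
      fix y assume "y \<in> carrier (cohomology2 K lam A V)"
      then obtain c where c: "c \<in> ?Z" "y = cohomology_class K lam A V c"
        by (auto simp: carrier_cohomology2)
      \<comment> \<open>A preimage of the class of \<open>c\<close> is the twisted sum of
        \<open>c\<close>, copied into the universe \<open>'e\<close> along \<open>j\<close>.\<close>
      obtain E where E: "E \<in> ?X" "isomorphic_extensions K V E (?T c)"
        using abelian_extension_copy[OF twisted_sum_abelian_extension[OF c(1)], of j] assms(6) by auto
      then have "y = \<Phi> (?R `` {E})"
        using Phi_class[OF E(1) c(1)] abelian_extensions_sym[OF E] c(2) by simp
      then show "y \<in> \<Phi> ` (?X // ?R)" using E(1) by (auto intro: quotientI)
    qed
  qed
  then show ?thesis using equiv sec val by blast
qed

end
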